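(* Let $K$ be a field, $R=K[x_1,\ldots,x_n]$ (so $n=\dim R$), and let $I_{c,\mathcal{F}}\subseteq R$ be the ideal of a star configuration of height $c$ on a set $\mathcal{F}=\{F_1,\ldots,F_t\}$ of homogeneous polynomials. Assume that $\mathcal{F}$ contains a regular sequence of length $n$. Then the following are equivalent: (1) $I_{c,\mathcal{F}}$ is of linear type. (2) $\mu(I_{c,\mathcal{F}})\le n$. (3) $c=2$ and $n=t$, i.e. $\mathcal{F}$ is a regular sequence.
   Context: For a set $\mathcal{F}=\{F_1,\ldots,F_t\}$ of homogeneous polynomials in $R$ and $1\le c\le\min\{n,t\}$, let $I_{c,\mathcal{F}}=\bigcap_{1\le i_1<\cdots<i_c\le t}(F_{i_1},\ldots,F_{i_c})$. It is called the ideal of the star configuration of height $c$ on $\mathcal{F}$ if every subset of $\mathcal{F}$ of cardinality $c+1$ is a regular sequence. $\mu(\cdot)$ denotes the minimal number of generators. An ideal $I=(g_1,\ldots,g_\mu)$ is of linear type if the kernel of the $R$-algebra map $R[T_1,\ldots,T_\mu]\to R[I\tau]\subseteq R[\tau]$, $T_i\mapsto g_i\tau$, is generated by elements that are homogeneous of degree one in the $T_i$.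
   Formalization: The formal statement additionally assumes c ≠ 1, and c = 2 whenever c = t; in the excluded cases (I principal, or c = t = n ≠ 2 with I a complete intersection) (1) and (2) hold but (3) fails, e.g. F = {x,y}, c = 1, or F = {x,y,z}, c = 3. *)

theory Defs
  imports
    "HOL-Library.Poly_Mapping"
    "HOL-Library.Cardinality"
    "HOL-Computational_Algebra.Polynomial"
begin

text \<open>
  \<open>('v, 'k) mvpoly\<close> is the polynomial ring over \<open>'k\<close> with one variable for every element of
  \<open>'v\<close>; a monomial is its finitely supported exponent function. For \<open>'v :: finite\<close> this is
  \<open>K[x\<^sub>1, \<dots>, x\<^sub>n]\<close> with \<open>n = CARD('v)\<close>.
\<close>

type_synonym ('v, 'k) mvpoly = "('v \<Rightarrow>\<^sub>0 nat) \<Rightarrow>\<^sub>0 'k"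

definition monom_degree :: "('v \<Rightarrow>\<^sub>0 nat) \<Rightarrow> nat" where
  "monom_degree m = (\<Sum>i\<in>Poly_Mapping.keys m. Poly_Mapping.lookup m i)"

definition homogeneous_of_degree :: "nat \<Rightarrow> ('v, 'k::zero) mvpoly \<Rightarrow> bool" where
  "homogeneous_of_degree d f \<longleftrightarrow> (\<forall>m\<in>Poly_Mapping.keys f. monom_degree m = d)"

definition homogeneous :: "('v, 'k::zero) mvpoly \<Rightarrow> bool" where
  "homogeneous f \<longleftrightarrow> (\<exists>d. homogeneous_of_degree d f)"

text \<open>An ideal of a commutative ring is a submodule of the ring over itself.\<close>

definition ideal_gen :: "'a::comm_ring_1 set \<Rightarrow> 'a set" where
  "ideal_gen S = module.span (*) S"

text \<open>Junk value if \<open>I\<close> is not a finitely generated ideal; all ideals of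
  \<open>('v::finite, 'k::field) mvpoly\<close> are finitely generated.\<close>

definition min_gens :: "'a::comm_ring_1 set \<Rightarrow> nat" where
  "min_gens I = (LEAST m. \<exists>S. finite S \<and> card S = m \<and> ideal_gen S = I)"

definition regular_sequence :: "'a::comm_ring_1 list \<Rightarrow> bool" where
  "regular_sequence xs \<longleftrightarrow>
     (\<forall>i<length xs. \<forall>r. r * xs ! i \<in> ideal_gen (set (take i xs)) \<longrightarrow> r \<in> ideal_gen (set (take i xs)))
     \<and> ideal_gen (set xs) \<noteq> UNIV"

text \<open>A set is a regular sequence if some ordering of it is one. For homogeneous polynomials the
  choice of the ordering does not matter.\<close>

definition regular_sequence_set :: "'a::comm_ring_1 set \<Rightarrow> bool" where
  "regular_sequence_set S \<longleftrightarrow> (\<exists>xs. distinct xs \<and> set xs = S \<and> regular_sequence xs)"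

definition star_ideal :: "nat \<Rightarrow> 'a::comm_ring_1 set \<Rightarrow> 'a set" where
  "star_ideal c F = (\<Inter>S\<in>{S. S \<subseteq> F \<and> card S = c}. ideal_gen S)"

definition star_configuration :: "nat \<Rightarrow> ('v::finite, 'k::field) mvpoly set \<Rightarrow> bool" where
  "star_configuration c F \<longleftrightarrow>
     finite F \<and> (\<forall>f\<in>F. homogeneous f) \<and> 1 \<le> c \<and> c \<le> min CARD('v) (card F) \<and>
     (\<forall>S. S \<subseteq> F \<and> card S = c + 1 \<longrightarrow> regular_sequence_set S)"

text \<open>
  \<open>R[T\<^sub>0, \<dots>, T\<^bsub>m-1\<^esub>]\<close>, with \<open>m\<close> a number rather than a type, is the subring of \<open>(nat, 'a) mvpoly\<close>
  of the polynomials involving only variables with index below \<open>m\<close>.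
\<close>

definition T_polys :: "nat \<Rightarrow> (nat, 'a::comm_ring_1) mvpoly set" where
  "T_polys m = {P. \<forall>u\<in>Poly_Mapping.keys P. Poly_Mapping.keys u \<subseteq> {..<m}}"

text \<open>The ideal generated by \<open>S\<close> in a subring \<open>A\<close> containing \<open>S\<close>.\<close>

definition ideal_gen_in :: "'a::comm_ring_1 set \<Rightarrow> 'a set \<Rightarrow> 'a set" where
  "ideal_gen_in A S = {(\<Sum>s\<in>B. a s * s) | a B. finite B \<and> B \<subseteq> S \<and> a ` B \<subseteq> A}"

text \<open>The \<open>R\<close>-algebra map \<open>R[T\<^sub>0, T\<^sub>1, \<dots>] \<rightarrow> R[\<tau>]\<close>, \<open>T\<^sub>i \<mapsto> g\<^sub>i \<tau>\<close>, where \<open>R[\<tau>]\<close> is \<open>'a poly\<close>;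
  only meant for arguments in \<open>T_polys (length gs)\<close>.\<close>

definition rees_map :: "'a::comm_ring_1 list \<Rightarrow> (nat, 'a) mvpoly \<Rightarrow> 'a poly" where
  "rees_map gs P = (\<Sum>u\<in>Poly_Mapping.keys P. smult (Poly_Mapping.lookup P u)
     (\<Prod>i\<in>Poly_Mapping.keys u. monom (gs ! i) 1 ^ Poly_Mapping.lookup u i))"

definition rees_kernel :: "'a::comm_ring_1 list \<Rightarrow> (nat, 'a) mvpoly set" where
  "rees_kernel gs = {P \<in> T_polys (length gs). rees_map gs P = 0}"

text \<open>The condition on the kernel does not depend on the chosen generators \<open>gs\<close> of \<open>I\<close>.\<close>

definition linear_type :: "'a::comm_ring_1 set \<Rightarrow> bool" where
  "linear_type I \<longleftrightarrow>
     (\<exists>gs. length gs = min_gens I \<and> ideal_gen (set gs) = I \<and>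
       (\<exists>L. L \<subseteq> T_polys (length gs) \<and> (\<forall>P\<in>L. homogeneous_of_degree 1 P) \<and>
            rees_kernel gs = ideal_gen_in (T_polys (length gs)) L))"

end

(*
  For f outside a subset T of F with at most c elements, f is a nonzerodivisor modulo (T), because
  homogeneous regular sequences can be permuted. Hence the ideal of the star configuration is
  generated by the products of card F - c + 1 elements of F, and all syzygies of these products have
  coefficients without constant term. So these products are minimal generators, and mu is the
  binomial coefficient of card F over c - 1.

  If mu > n, then a count of monomials gives a relation among the products that stays nonzero modulo
  the irrelevant ideal, whereas all linear relations vanish there; so linear type implies mu <= n.
  If F is a regular sequence and c = 2, the relations F_i T_i - F_j T_j generate the kernel of the
  Rees map. These two facts together show that a homogeneous regular sequence has at most n elements,
  and they reduce the remaining implications to inequalities between binomial coefficients.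
*)

theory Submission
  imports Defs "HOL-Library.FuncSet"
begin

section \<open>Ideals, evaluation of polynomials and homogeneous parts\<close>

text \<open>Both inductions over the family, the one for the generators and the one for the Rees
  kernel, split off one element and have to continue modulo that element. Their statements are
  therefore relative to a base set (\<open>S\<close> in \<open>inter_eq_prods\<close>,
  \<open>B\<close> in \<open>kernel_mod_syzygies\<close>) that collects such elements, and
  regularity is phrased as \<open>nonzerodivisor_mod\<close> over the base instead of in quotient
  rings.

  Positive degree has two uses. A power of a form contributes nothing in low degrees, so a regular
  form can be removed from the base again; and all the forms have constant term 0, so that working
  modulo the irrelevant ideal amounts to taking constant terms.

  In the count of monomials the generators may have different degrees. Products of them are padded
  with powers of one variable, but padding could make the whole relation vanish modulo the
  irrelevant ideal; cancelling the least power leaves a term with a nonzero scalar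
  coefficient.\<close>

lemma module_mult: "module ((*) :: 'a::comm_ring_1 \<Rightarrow> 'a \<Rightarrow> 'a)"
  by unfold_locales (simp_all add: algebra_simps)

lemmas ideal_gen_base = module.span_base[OF module_mult, folded ideal_gen_def]
  and ideal_gen_zero = module.span_zero[OF module_mult, folded ideal_gen_def]
  and ideal_gen_add = module.span_add[OF module_mult, folded ideal_gen_def]
  and ideal_gen_diff = module.span_diff[OF module_mult, folded ideal_gen_def]
  and ideal_gen_mult = module.span_scale[OF module_mult, folded ideal_gen_def]
  and ideal_gen_sum = module.span_sum[OF module_mult, folded ideal_gen_def]
  and ideal_gen_mono = module.span_mono[OF module_mult, folded ideal_gen_def]
  and ideal_gen_insert_iff = module.span_breakdown_eq[OF module_mult, folded ideal_gen_def]
  and ideal_gen_induct = module.span_induct_alt[OF module_mult, folded ideal_gen_def, consumes 1, case_names base step]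
  and ideal_gen_explicit = module.span_explicit[OF module_mult, folded ideal_gen_def]
  and ideal_gen_finite = module.span_finite[OF module_mult, folded ideal_gen_def]

lemma ideal_gen_subset: "S \<subseteq> ideal_gen T \<Longrightarrow> ideal_gen S \<subseteq> ideal_gen T"
  unfolding ideal_gen_def by (rule module.span_minimal[OF module_mult _ module.subspace_span[OF module_mult]])

lemma ideal_gen_insertE:
  assumes "r \<in> ideal_gen (insert x S)"
  obtains i s where "i \<in> ideal_gen S" "r = i + s * x"
  using assms that unfolding ideal_gen_insert_iff
  by (metis diff_add_cancel)

lemma ideal_gen_mult2: "s \<in> ideal_gen S \<Longrightarrow> s * r \<in> ideal_gen S"
  using ideal_gen_mult[of s S r] by (simp add: mult.commute)

definition ring_map :: "('a::comm_ring_1 \<Rightarrow> 'b::comm_ring_1) \<Rightarrow> bool" where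
  "ring_map \<phi> \<longleftrightarrow> \<phi> 1 = 1 \<and> (\<forall>a b. \<phi> (a + b) = \<phi> a + \<phi> b) \<and> (\<forall>a b. \<phi> (a * b) = \<phi> a * \<phi> b)"

lemma ring_map_simps:
  assumes "ring_map \<phi>"
  shows "\<phi> 1 = 1" "\<phi> (a + b) = \<phi> a + \<phi> b" "\<phi> (a * b) = \<phi> a * \<phi> b" "\<phi> 0 = 0" "\<phi> (- a) = - \<phi> a"
    "\<phi> (a - b) = \<phi> a - \<phi> b" "\<phi> (a ^ k) = \<phi> a ^ k" "\<phi> (sum f A) = (\<Sum>x\<in>A. \<phi> (f x))"
    "\<phi> (prod f A) = (\<Prod>x\<in>A. \<phi> (f x))"
proof -
  show 1: "\<phi> 1 = 1" and add: "\<phi> (a + b) = \<phi> a + \<phi> b" and mult: "\<phi> (a * b) = \<phi> a * \<phi> b" for a b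
    using assms by (auto simp: ring_map_def)
  show 0: "\<phi> 0 = 0" using add[of 0 0] by simp
  show um: "\<phi> (- a) = - \<phi> a" for a using add[of "-a" a] 0 by (simp add: eq_neg_iff_add_eq_0)
  show "\<phi> (a - b) = \<phi> a - \<phi> b" using add[of a "-b"] um[of b] by simp
  show "\<phi> (a ^ k) = \<phi> a ^ k" by (induction k) (auto simp: 1 mult)
  show "\<phi> (sum f A) = (\<Sum>x\<in>A. \<phi> (f x))" by (induction A rule: infinite_finite_induct) (auto simp: 0 add)
  show "\<phi> (prod f A) = (\<Prod>x\<in>A. \<phi> (f x))" by (induction A rule: infinite_finite_induct) (auto simp: 1 mult)
qed

lemma ring_map_comp: "ring_map \<phi> \<Longrightarrow> ring_map \<psi> \<Longrightarrow> ring_map (\<lambda>x. \<phi> (\<psi> x))"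
  by (simp add: ring_map_def)

lemma ring_map_ideal_gen_eq_0:
  assumes "ring_map \<phi>" "r \<in> ideal_gen S" "\<And>s. s \<in> S \<Longrightarrow> \<phi> s = 0"
  shows "\<phi> r = 0"
  using assms(2)
  by (induction rule: ideal_gen_induct)
    (auto simp: ring_map_simps[OF assms(1)] assms(3))

lemma ring_map_id: "ring_map (\<lambda>x. x)"
  by (simp add: ring_map_def)

lemma poly_mapping_sum_single:
  fixes P :: "('a \<Rightarrow>\<^sub>0 'b::comm_monoid_add)"
  assumes "finite A" "Poly_Mapping.keys P \<subseteq> A"
  shows "P = (\<Sum>u\<in>A. Poly_Mapping.single u (Poly_Mapping.lookup P u))"
  using assms
  by (intro poly_mapping_eqI) (auto simp: lookup_sum lookup_single when_def not_in_keys_iff_lookup_eq_zero subset_iff)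

definition eval_monom :: "('i \<Rightarrow> 'b::comm_ring_1) \<Rightarrow> ('i \<Rightarrow>\<^sub>0 nat) \<Rightarrow> 'b" where
  "eval_monom v u = (\<Prod>i\<in>Poly_Mapping.keys u. v i ^ Poly_Mapping.lookup u i)"

text \<open>Constant terms, the truncation of variables, the Rees map, the cofactor map and the
  specialisation \<open>\<Psi>\<close> are all instances, so one proof makes them ring
  homomorphisms. The map \<open>\<phi>\<close> allows a change of the coefficient ring.\<close>

definition eval_poly :: "('a::comm_ring_1 \<Rightarrow> 'b::comm_ring_1) \<Rightarrow> ('i \<Rightarrow> 'b) \<Rightarrow> ('i, 'a) mvpoly \<Rightarrow> 'b" where
  "eval_poly \<phi> v P = (\<Sum>u\<in>Poly_Mapping.keys P. \<phi> (Poly_Mapping.lookup P u) * eval_monom v u)"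

lemma eval_monom_superset:
  assumes "finite A" "Poly_Mapping.keys u \<subseteq> A"
  shows "eval_monom v u = (\<Prod>i\<in>A. v i ^ Poly_Mapping.lookup u i)"
  unfolding eval_monom_def using assms
  by (intro prod.mono_neutral_left) (auto simp: in_keys_iff)

lemma eval_monom_add: "eval_monom v (u + w) = eval_monom v u * eval_monom v w"
  using keys_add[of u w]
  by (simp add: eval_monom_superset[of "Poly_Mapping.keys u \<union> Poly_Mapping.keys w"] lookup_add power_add prod.distrib)

lemma eval_monom_0 [simp]: "eval_monom v 0 = 1"
  by (simp add: eval_monom_def)

lemma eval_monom_single [simp]: "eval_monom v (Poly_Mapping.single i k) = v i ^ k"
  by (simp add: eval_monom_def)

lemma eval_poly_superset:
  assumes "ring_map \<phi>" "finite A" "Poly_Mapping.keys P \<subseteq> A"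
  shows "eval_poly \<phi> v P = (\<Sum>u\<in>A. \<phi> (Poly_Mapping.lookup P u) * eval_monom v u)"
  unfolding eval_poly_def using assms
  by (intro sum.mono_neutral_left) (auto simp: in_keys_iff ring_map_simps[OF assms(1)])

lemma eval_poly_add:
  assumes "ring_map \<phi>"
  shows "eval_poly \<phi> v (P + Q) = eval_poly \<phi> v P + eval_poly \<phi> v Q"
  using keys_add[of P Q]
  by (simp add: eval_poly_superset[OF assms, of "Poly_Mapping.keys P \<union> Poly_Mapping.keys Q"] lookup_add sum.distrib
      ring_map_simps[OF assms] algebra_simps)

lemma eval_poly_single:
  assumes "ring_map \<phi>"
  shows "eval_poly \<phi> v (Poly_Mapping.single u c) = \<phi> c * eval_monom v u"
  by (auto simp: eval_poly_def ring_map_simps[OF assms])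

lemma eval_poly_0 [simp]: "eval_poly \<phi> v 0 = 0"
  by (simp add: eval_poly_def)

lemma eval_poly_sum:
  assumes "ring_map \<phi>"
  shows "eval_poly \<phi> v (sum f A) = (\<Sum>x\<in>A. eval_poly \<phi> v (f x))"
  by (induction A rule: infinite_finite_induct) (auto simp: eval_poly_add[OF assms])

lemma eval_poly_mult:
  assumes "ring_map \<phi>"
  shows "eval_poly \<phi> v (P * Q) = eval_poly \<phi> v P * eval_poly \<phi> v Q"
proof -
  have P: "P = (\<Sum>u\<in>Poly_Mapping.keys P. Poly_Mapping.single u (Poly_Mapping.lookup P u))"
    and Q: "Q = (\<Sum>u\<in>Poly_Mapping.keys Q. Poly_Mapping.single u (Poly_Mapping.lookup Q u))"
    by (rule poly_mapping_sum_single; simp)+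
  have "P * Q = (\<Sum>u\<in>Poly_Mapping.keys P. \<Sum>w\<in>Poly_Mapping.keys Q.
      Poly_Mapping.single (u + w) (Poly_Mapping.lookup P u * Poly_Mapping.lookup Q w))"
    by (rule trans[OF arg_cong2[where f = "(*)", OF P Q]]) (simp only: sum_product mult_single)
  then have "eval_poly \<phi> v (P * Q) =
      eval_poly \<phi> v (\<Sum>u\<in>Poly_Mapping.keys P. \<Sum>w\<in>Poly_Mapping.keys Q. Poly_Mapping.single (u + w) (Poly_Mapping.lookup P u * Poly_Mapping.lookup Q w))"
    by (rule arg_cong)
  also have "\<dots> = (\<Sum>u\<in>Poly_Mapping.keys P. \<Sum>w\<in>Poly_Mapping.keys Q. (\<phi> (Poly_Mapping.lookup P u) * eval_monom v u) * (\<phi> (Poly_Mapping.lookup Q w) * eval_monom v w))"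
    unfolding eval_poly_sum[OF assms] eval_poly_single[OF assms] eval_monom_add ring_map_simps(3)[OF assms]
    by (intro sum.cong refl) (simp only: mult_ac)
  finally show ?thesis by (simp add: eval_poly_def sum_product)
qed

lemma ring_map_eval_poly: "ring_map \<phi> \<Longrightarrow> ring_map (eval_poly \<phi> v)"
  using eval_poly_single[of \<phi> v 0 1]
  by (auto simp: ring_map_def eval_poly_add eval_poly_mult)

section \<open>Degrees, constant terms and homogeneous components\<close>

lemma monom_degree_superset: "finite A \<Longrightarrow> Poly_Mapping.keys u \<subseteq> A \<Longrightarrow> monom_degree u = (\<Sum>i\<in>A. Poly_Mapping.lookup u i)"
  unfolding monom_degree_def by (intro sum.mono_neutral_left) (auto simp: in_keys_iff)

lemma monom_degree_add: "monom_degree (u + w) = monom_degree u + monom_degree w"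
  using keys_add[of u w]
  by (simp add: monom_degree_superset[of "Poly_Mapping.keys u \<union> Poly_Mapping.keys w"] lookup_add sum.distrib)

lemma monom_degree_0 [simp]: "monom_degree 0 = 0"
  by (simp add: monom_degree_def)

lemma monom_degree_single [simp]: "monom_degree (Poly_Mapping.single i k) = k"
  by (simp add: monom_degree_def)

lemma monom_degree_eq_0_iff: "monom_degree u = 0 \<longleftrightarrow> u = 0"
  by (auto simp: monom_degree_def in_keys_iff intro!: poly_mapping_eqI)
 
lemma eval_monom_zero: "eval_monom (\<lambda>_. 0) u = (if u = 0 then 1 else (0::'b::comm_ring_1))"
proof (cases "u = 0")
  case False
  then obtain i where "i \<in> Poly_Mapping.keys u" by (metis all_not_in_conv keys_eq_empty)
  then have "\<exists>i\<in>Poly_Mapping.keys u. (0::'b) ^ Poly_Mapping.lookup u i = 0" by (intro bexI[of _ i]) (auto simp: in_keys_iff zero_power)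
  then show ?thesis using False by (auto simp: eval_monom_def intro: prod_zero)
qed simp

definition const_coeff :: "('v, 'k::comm_ring_1) mvpoly \<Rightarrow> 'k" where
  "const_coeff f = Poly_Mapping.lookup f 0"

lemma const_coeff_eq_eval: "const_coeff f = eval_poly (\<lambda>x. x) (\<lambda>_. 0) f"
  by (auto simp: eval_poly_def eval_monom_zero const_coeff_def if_distrib in_keys_iff cong: if_cong)

lemma ring_map_const_coeff: "ring_map const_coeff"
proof -
  have "const_coeff = (eval_poly (\<lambda>x. x) (\<lambda>_. 0) :: ('v, 'k::comm_ring_1) mvpoly \<Rightarrow> 'k)"
    by (rule ext) (rule const_coeff_eq_eval)
  then show ?thesis using ring_map_eval_poly[OF ring_map_id] by metis
qed

lemma ring_map_single_0: "ring_map (Poly_Mapping.single 0)"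
  by (simp add: ring_map_def single_add mult_single)

lemma homogeneous_of_degree_0 [simp]: "homogeneous_of_degree d 0"
  by (simp add: homogeneous_of_degree_def)

lemma homogeneous_of_degree_add:
  "homogeneous_of_degree d f \<Longrightarrow> homogeneous_of_degree d g \<Longrightarrow> homogeneous_of_degree d (f + g)"
  using keys_add[of f g] by (auto simp: homogeneous_of_degree_def)

lemma homogeneous_of_degree_mult:
  fixes f g :: "('v, 'k::comm_ring_1) mvpoly"
  shows "homogeneous_of_degree d f \<Longrightarrow> homogeneous_of_degree e g \<Longrightarrow> homogeneous_of_degree (d + e) (f * g)"
  using keys_mult[of f g] by (fastforce simp: homogeneous_of_degree_def monom_degree_add)

lemma homogeneous_of_degree_1 [simp]: "homogeneous_of_degree 0 (1 :: ('v, 'k::comm_ring_1) mvpoly)"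
  by (simp add: homogeneous_of_degree_def)

lemma homogeneous_of_degree_power:
  fixes f :: "('v, 'k::comm_ring_1) mvpoly"
  shows "homogeneous_of_degree d f \<Longrightarrow> homogeneous_of_degree (k * d) (f ^ k)"
  by (induction k) (auto dest: homogeneous_of_degree_mult)

lemma homogeneous_of_degree_prod:
  fixes f :: "'i \<Rightarrow> ('v, 'k::comm_ring_1) mvpoly"
  shows "(\<And>x. x \<in> A \<Longrightarrow> homogeneous_of_degree (d x) (f x)) \<Longrightarrow> homogeneous_of_degree (sum d A) (prod f A)"
  by (induction A rule: infinite_finite_induct) (auto intro: homogeneous_of_degree_mult)

lemma homogeneous_of_degree_single [simp]:
  "homogeneous_of_degree d (Poly_Mapping.single u c) \<longleftrightarrow> c = 0 \<or> monom_degree u = d"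
  by (auto simp: homogeneous_of_degree_def)

definition degree_part :: "nat \<Rightarrow> ('v, 'k::comm_ring_1) mvpoly \<Rightarrow> ('v, 'k) mvpoly" where
  "degree_part d f = (\<Sum>u\<in>{u\<in>Poly_Mapping.keys f. monom_degree u = d}. Poly_Mapping.single u (Poly_Mapping.lookup f u))"

lemma lookup_degree_part: "Poly_Mapping.lookup (degree_part d f) u = (if monom_degree u = d then Poly_Mapping.lookup f u else 0)"
  by (simp add: degree_part_def lookup_sum lookup_single when_def in_keys_iff)

lemma keys_degree_part: "Poly_Mapping.keys (degree_part d f) = {u\<in>Poly_Mapping.keys f. monom_degree u = d}"
  by (auto simp: in_keys_iff lookup_degree_part split: if_splits)

lemma homogeneous_degree_part: "homogeneous_of_degree d (degree_part d f)"
  by (simp add: homogeneous_of_degree_def keys_degree_part)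

lemma degree_part_homogeneous:
  "homogeneous_of_degree e f \<Longrightarrow> degree_part d f = (if d = e then f else 0)"
  by (intro poly_mapping_eqI) (auto simp: homogeneous_of_degree_def lookup_degree_part in_keys_iff)

lemma degree_part_add: "degree_part d (f + g) = degree_part d f + degree_part d g"
  by (intro poly_mapping_eqI) (auto simp: lookup_degree_part lookup_add)

lemma degree_part_0 [simp]: "degree_part d 0 = 0"
  by (simp add: degree_part_def)

lemma degree_part_sum: "degree_part d (sum f A) = (\<Sum>x\<in>A. degree_part d (f x))"
  by (induction A rule: infinite_finite_induct) (auto simp: degree_part_add)

lemma sum_degree_parts:
  assumes "finite A" "monom_degree ` Poly_Mapping.keys f \<subseteq> A"
  shows "(\<Sum>d\<in>A. degree_part d f) = f"
  using assms by (intro poly_mapping_eqI) (auto simp: lookup_sum lookup_degree_part image_subset_iff Ball_def in_keys_iff)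

text \<open>A homogeneous factor of degree \<open>e\<close> shifts all degrees by \<open>e\<close>.
  The vanishing case \<open>d < e\<close> is what ends the iteration in
  \<open>nonzerodivisor_mod_drop\<close>.\<close>

lemma degree_part_mult_homogeneous:
  assumes "homogeneous_of_degree e f"
  shows "degree_part d (a * f) = (if e \<le> d then degree_part (d - e) a * f else 0)"
proof -
  \<comment> \<open>The degree \<open>d - e\<close> is included even if \<open>a\<close> has no
    component there, so that the only term that can survive is always indexed.\<close>
  let ?A = "monom_degree ` Poly_Mapping.keys a \<union> {d - e}"
  have "degree_part d (a * f) = degree_part d ((\<Sum>k\<in>?A. degree_part k a) * f)"
    by (subst sum_degree_parts) auto
  also have "\<dots> = (\<Sum>k\<in>?A. degree_part d (degree_part k a * f))"
    by (simp add: sum_distrib_right degree_part_sum)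
  also have "\<dots> = (\<Sum>k\<in>?A. if d = k + e then degree_part k a * f else 0)"
    by (intro sum.cong refl degree_part_homogeneous homogeneous_of_degree_mult homogeneous_degree_part assms)
  also have "\<dots> = (if e \<le> d then degree_part (d - e) a * f else 0)"
  proof (cases "e \<le> d")
    case True
    then have "d = k + e \<longleftrightarrow> k = d - e" for k by auto
    then show ?thesis using True by (simp only:) simp
  qed simp
  finally show ?thesis .
qed

lemma degree_part_ideal_gen:
  assumes "\<And>s. s \<in> S \<Longrightarrow> homogeneous s" "f \<in> ideal_gen S"
  shows "degree_part d f \<in> ideal_gen S"
  using assms(2)
proof (induction rule: ideal_gen_induct)
  case (step a s f)
  then obtain e where "homogeneous_of_degree e s" using assms(1) by (auto simp: homogeneous_def)
  with step show ?case
    by (simp add: degree_part_add degree_part_mult_homogeneous ideal_gen_add ideal_gen_mult ideal_gen_base)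
qed (simp add: ideal_gen_zero)

section \<open>Permutability of homogeneous regular sequences\<close>

definition nonzerodivisor_mod :: "'a::comm_ring_1 \<Rightarrow> 'a set \<Rightarrow> bool" where
  "nonzerodivisor_mod f S \<longleftrightarrow> (\<forall>r. r * f \<in> ideal_gen S \<longrightarrow> r \<in> ideal_gen S)"

lemma nonzerodivisor_modD: "nonzerodivisor_mod f S \<Longrightarrow> r * f \<in> ideal_gen S \<Longrightarrow> r \<in> ideal_gen S"
  by (simp add: nonzerodivisor_mod_def)

lemma nonzerodivisor_mod_prod:
  assumes "\<And>x. x \<in> A \<Longrightarrow> nonzerodivisor_mod (h x) S" "r * (\<Prod>x\<in>A. h x) \<in> ideal_gen S"
  shows "r \<in> ideal_gen S"
  using assms
proof (induction A arbitrary: r rule: infinite_finite_induct)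
  case (insert x A)
  then have "r * (\<Prod>x\<in>A. h x) * h x \<in> ideal_gen S" by (simp add: mult_ac)
  then have "r * (\<Prod>x\<in>A. h x) \<in> ideal_gen S" using insert.prems(1) by (auto dest: nonzerodivisor_modD)
  then show ?case using insert by auto
qed auto

lemma nonzerodivisor_mod_power:
  assumes "nonzerodivisor_mod x S" "r * x ^ k \<in> ideal_gen S"
  shows "r \<in> ideal_gen S"
  using nonzerodivisor_mod_prod[of "{..<k}" "\<lambda>_. x"] assms by simp

text \<open>Zero qualifies, being homogeneous of every degree; nonzero constants do not.\<close>

definition pos_homogeneous :: "('v, 'k::zero) mvpoly \<Rightarrow> bool" where
  "pos_homogeneous f \<longleftrightarrow> (\<exists>d>0. homogeneous_of_degree d f)"

lemma pos_homogeneousD: "pos_homogeneous f \<Longrightarrow> homogeneous f"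
  by (auto simp: pos_homogeneous_def homogeneous_def)

lemma const_coeff_pos_homogeneous: "pos_homogeneous f \<Longrightarrow> const_coeff f = 0"
  by (force simp: pos_homogeneous_def homogeneous_of_degree_def const_coeff_def in_keys_iff)

text \<open>One half of exchanging neighbours in a regular sequence, valid in every commutative
  ring. If \<open>r * x = i + s * y\<close>, regularity of \<open>y\<close> modulo \<open>x\<close>
  gives \<open>s = j + q * x\<close>; then \<open>(r - q * y) * x\<close> vanishes modulo
  \<open>S\<close>, and \<open>x\<close> cancels.\<close>

lemma nonzerodivisor_mod_insert_commute:
  assumes "nonzerodivisor_mod x S" "nonzerodivisor_mod y (insert x S)"
  shows "nonzerodivisor_mod x (insert y S)"
  unfolding nonzerodivisor_mod_def
proof (intro allI impI)
  fix r assume "r * x \<in> ideal_gen (insert y S)"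
  then obtain i s where i: "i \<in> ideal_gen S" "r * x = i + s * y" by (rule ideal_gen_insertE)
  then have "s * y - r * x \<in> ideal_gen S"
    using ideal_gen_diff[OF ideal_gen_zero i(1)] by (simp add: algebra_simps)
  then have "s * y \<in> ideal_gen (insert x S)" unfolding ideal_gen_insert_iff by blast
  then have "s \<in> ideal_gen (insert x S)" using assms(2) by (rule nonzerodivisor_modD[rotated])
  then obtain j q where j: "j \<in> ideal_gen S" "s = j + q * x" by (rule ideal_gen_insertE)
  have "(r - q * y) * x = i + y * j" using i j by (simp add: algebra_simps)
  also have "\<dots> \<in> ideal_gen S" using i j by (intro ideal_gen_add ideal_gen_mult)
  finally have "r - q * y \<in> ideal_gen S" using assms(1) by (auto dest: nonzerodivisor_modD)
  then show "r \<in> ideal_gen (insert y S)" unfolding ideal_gen_insert_iff by blast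
qed

text \<open>The other half of the exchange, which fails without a grading. Regularity modulo
  \<open>x\<close> can be applied repeatedly, so \<open>r\<close> lies in the ideal of
  \<open>S\<close> and \<open>x ^ k\<close> for every \<open>k\<close>. As \<open>x\<close> has
  positive degree, the multiple of \<open>x ^ k\<close> does not reach a given degree once
  \<open>k\<close> is large.\<close>

lemma nonzerodivisor_mod_drop:
  fixes x y :: "('v, 'k::comm_ring_1) mvpoly"
  assumes S: "\<And>s. s \<in> S \<Longrightarrow> homogeneous s" and "pos_homogeneous x"
    and x: "nonzerodivisor_mod x S" and y: "nonzerodivisor_mod y (insert x S)"
  shows "nonzerodivisor_mod y S"
  unfolding nonzerodivisor_mod_def
proof (intro allI impI)
  fix r assume r: "r * y \<in> ideal_gen S"
  obtain e where e: "e > 0" "homogeneous_of_degree e x"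
    using assms(2) by (auto simp: pos_homogeneous_def)
  \<comment> \<open>The conjunct on \<open>s * y\<close> is the invariant: it lets the next factor
    \<open>x\<close> be split off from \<open>s\<close>.\<close>
  have step: "\<exists>i s. i \<in> ideal_gen S \<and> r = i + s * x ^ k \<and> s * y \<in> ideal_gen S" for k
  proof (induction k)
    case 0
    show ?case by (intro exI[of _ 0] exI[of _ r]) (auto simp: r ideal_gen_zero)
  next
    case (Suc k)
    then obtain i s where i: "i \<in> ideal_gen S" "r = i + s * x ^ k" "s * y \<in> ideal_gen S" by blast
    then have "s * y \<in> ideal_gen (insert x S)" using ideal_gen_mono[of S "insert x S"] by auto
    then have "s \<in> ideal_gen (insert x S)" using y by (rule nonzerodivisor_modD[rotated])
    then obtain j q where j: "j \<in> ideal_gen S" "s = j + q * x" by (rule ideal_gen_insertE)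
    have "(q * y) * x = s * y - y * j" using j by (simp add: algebra_simps)
    also have "\<dots> \<in> ideal_gen S" by (intro ideal_gen_diff ideal_gen_mult i(3) j(1))
    finally have "q * y \<in> ideal_gen S" using x by (auto dest: nonzerodivisor_modD)
    moreover have "r = (i + x ^ k * j) + q * x ^ Suc k" using i j by (simp add: algebra_simps)
    ultimately show ?case using i j by (metis ideal_gen_add ideal_gen_mult)
  qed
  have "degree_part d r \<in> ideal_gen S" for d
  proof -
    \<comment> \<open>\<open>x ^ Suc d\<close> has degree at least \<open>d + 1\<close>, so its
      multiples have no part of degree \<open>d\<close>.\<close>
    obtain i s where i: "i \<in> ideal_gen S" "r = i + s * x ^ Suc d" using step[of "Suc d"] by blast
    have "homogeneous_of_degree (Suc d * e) (x ^ Suc d)" using e by (intro homogeneous_of_degree_power)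
    moreover have "\<not> Suc d * e \<le> d" using e by (cases e) auto
    ultimately have "degree_part d (s * x ^ Suc d) = 0"
      by (simp only: degree_part_mult_homogeneous if_False)
    then have "degree_part d r = degree_part d i" using i(2) degree_part_add by (metis add.right_neutral)
    then show ?thesis using degree_part_ideal_gen[of S i] S i by auto
  qed
  then have "(\<Sum>d\<in>monom_degree ` Poly_Mapping.keys r. degree_part d r) \<in> ideal_gen S"
    by (intro ideal_gen_sum)
  then show "r \<in> ideal_gen S" by (simp add: sum_degree_parts)
qed

text \<open>The induction moves the head \<open>x\<close> of the list into \<open>S\<close>, so its
  hypothesis treats subsets of the tail modulo \<open>x\<close>. If \<open>x\<close> is in
  \<open>B\<close>, this suffices; if \<open>f = x\<close>, the elements of \<open>B\<close> are
  added one at a time by the first half of the exchange; otherwise \<open>x\<close> is dropped from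
  the base by the second half.\<close>

lemma nonzerodivisor_mod_permute:
  fixes xs :: "('v, 'k::comm_ring_1) mvpoly list"
  assumes "\<forall>x\<in>set xs. pos_homogeneous x"
    and "\<forall>i<length xs. nonzerodivisor_mod (xs ! i) (S \<union> set (take i xs))"
    and "\<forall>s\<in>S. homogeneous s" and "B \<subseteq> set xs" and "f \<in> set xs - B"
  shows "nonzerodivisor_mod f (S \<union> B)"
  using assms
proof (induction xs arbitrary: S B f)
  case Nil
  then show ?case by simp
next
  case (Cons x ys)
  have S': "\<forall>s\<in>insert x S. homogeneous s" using Cons.prems by (auto dest: pos_homogeneousD)
  have "\<forall>i<length ys. nonzerodivisor_mod (ys ! i) (insert x S \<union> set (take i ys))"
  proof (intro allI impI)
    fix i assume "i < length ys"
    then show "nonzerodivisor_mod (ys ! i) (insert x S \<union> set (take i ys))"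
      using Cons.prems(2)[rule_format, of "Suc i"] by simp
  qed
  then have IH: "nonzerodivisor_mod g (insert x (S \<union> A))" if "A \<subseteq> set ys" "g \<in> set ys - A" for A g
    using Cons.IH[of "insert x S" A g] Cons.prems that S' by auto
  have x0: "nonzerodivisor_mod x S" using Cons.prems(2)[rule_format, of 0] by simp
  have xA: "nonzerodivisor_mod x (S \<union> A)" if "A \<subseteq> set ys" for A
  proof -
    have "finite A" using that finite_subset by blast
    then show ?thesis using that
    proof (induction A)
      case (insert b A)
      then show ?case using nonzerodivisor_mod_insert_commute[of x "S \<union> A" b] IH[of A b] by auto
    qed (simp add: x0)
  qed
  have hom: "homogeneous s" if "s \<in> S \<union> A" "A \<subseteq> set ys" for s A
    using that Cons.prems by (auto dest: pos_homogeneousD)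
  consider "x \<in> B" | "x \<notin> B" "f = x" | "x \<notin> B" "f \<noteq> x" by blast
  then show ?case
  proof cases
    case 1
    then have "insert x (S \<union> (B - {x})) = S \<union> B" by blast
    then show ?thesis using 1 IH[of "B - {x}" f] Cons.prems by auto
  next
    case 2
    then show ?thesis using xA Cons.prems by auto
  next
    case 3
    then have B: "B \<subseteq> set ys" using Cons.prems by auto
    show ?thesis
      using nonzerodivisor_mod_drop[of "S \<union> B" x f] hom[OF _ B] xA[OF B] IH[of B f] B 3 Cons.prems by auto
  qed
qed

lemma ideal_gen_eq_UNIV_iff: "ideal_gen S = UNIV \<longleftrightarrow> (1 :: 'a::comm_ring_1) \<in> ideal_gen S"
  using ideal_gen_mult[of 1 S] by auto

text \<open>A form of degree 0 is a constant. A nonzero one is a unit, and zero would put 1 into the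
  ideal of its predecessors; both contradict that the ideal of the sequence is proper.\<close>

lemma pos_homogeneous_of_regular_sequence:
  fixes f :: "('v, 'k::field) mvpoly"
  assumes reg: "regular_sequence xs" and f: "f \<in> set xs" "homogeneous f"
  shows "pos_homogeneous f"
proof -
  have neq: "(1 :: ('v, 'k) mvpoly) \<notin> ideal_gen (set xs)"
    using reg by (auto simp: regular_sequence_def ideal_gen_eq_UNIV_iff)
  obtain d where d: "homogeneous_of_degree d f" using f(2) by (auto simp: homogeneous_def)
  show ?thesis
  proof (cases "d = 0")
    case True
    then have keys: "Poly_Mapping.keys f \<subseteq> {0}"
      using d by (auto simp: homogeneous_of_degree_def monom_degree_eq_0_iff)
    define c where "c = const_coeff f"
    have fc: "f = Poly_Mapping.single 0 c"
      using poly_mapping_sum_single[OF _ keys] by (simp add: c_def const_coeff_def)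
    show ?thesis
    proof (cases "c = 0")
      case True
      obtain i where "i < length xs" "xs ! i = f" using f(1) by (auto simp: in_set_conv_nth)
      then have "1 \<in> ideal_gen (set (take i xs))"
        using reg fc True by (auto simp: regular_sequence_def ideal_gen_zero)
      then show ?thesis using neq ideal_gen_mono[OF set_take_subset] by blast
    next
      case False
      then have "Poly_Mapping.single 0 (1 / c) * f = 1" by (simp add: fc mult_single)
      then show ?thesis using neq ideal_gen_mult[OF ideal_gen_base[OF f(1)]] by metis
    qed
  qed (use d in \<open>auto simp: pos_homogeneous_def\<close>)
qed

lemma regular_sequence_set_nonzerodivisor:
  fixes G :: "('v, 'k::field) mvpoly set"
  assumes "regular_sequence_set G" "\<forall>f\<in>G. homogeneous f" "B \<subseteq> G" "f \<in> G - B"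
  shows "nonzerodivisor_mod f B"
proof -
  obtain xs where xs: "set xs = G" "regular_sequence xs"
    using assms(1) by (auto simp: regular_sequence_set_def)
  then have "\<forall>x\<in>set xs. pos_homogeneous x"
    using assms(2) pos_homogeneous_of_regular_sequence by blast
  then have "nonzerodivisor_mod f ({} \<union> B)"
    by (rule nonzerodivisor_mod_permute[of xs])
      (use xs assms in \<open>auto simp: regular_sequence_def nonzerodivisor_mod_def\<close>)
  then show ?thesis by simp
qed

lemma regular_sequence_set_pos_homogeneous:
  fixes G :: "('v, 'k::field) mvpoly set"
  assumes "regular_sequence_set G" "\<forall>f\<in>G. homogeneous f" "f \<in> G"
  shows "pos_homogeneous f"
  using assms pos_homogeneous_of_regular_sequence by (auto simp: regular_sequence_set_def)

section \<open>Generators of star configuration ideals\<close>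

text \<open>Pigeonhole: \<open>card A + card T = card F + 1\<close>, so some factor of
  \<open>\<Prod>A\<close> lies in \<open>T\<close>.\<close>

lemma prods_subset_inter:
  assumes "finite F" "c \<le> card F"
  shows "ideal_gen (S \<union> {\<Prod>A |A. A \<subseteq> F \<and> card A = card F - c + 1})
    \<subseteq> (\<Inter>T\<in>{T. T \<subseteq> F \<and> card T = c}. ideal_gen (S \<union> T))"
proof (intro INT_greatest ideal_gen_subset subsetI)
  fix T x assume T: "T \<in> {T. T \<subseteq> F \<and> card T = c}"
    and x: "x \<in> S \<union> {\<Prod>A |A. A \<subseteq> F \<and> card A = card F - c + 1}"
  show "x \<in> ideal_gen (S \<union> T)"
  proof (cases "x \<in> S")
    case False
    then obtain A where A: "A \<subseteq> F" "card A = card F - c + 1" "x = \<Prod>A" using x by auto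
    have fin: "finite A" "finite T" using A T assms finite_subset by auto
    have "A \<inter> T \<noteq> {}"
    proof
      assume "A \<inter> T = {}"
      then have "card (A \<union> T) = card A + card T" using fin card_Un_disjoint by blast
      moreover have "card (A \<union> T) \<le> card F" using A T assms by (intro card_mono) auto
      ultimately show False using A T assms by auto
    qed
    then obtain f where f: "f \<in> A" "f \<in> T" by auto
    have "x = \<Prod>(A - {f}) * f" using f fin A by (simp add: prod.remove mult.commute)
    then show ?thesis using f by (auto intro: ideal_gen_mult ideal_gen_base)
  qed (auto intro: ideal_gen_base)
qed

text \<open>For \<open>insert f G\<close>, the sets \<open>T\<close> containing \<open>f\<close>
  give, by induction modulo \<open>f\<close>, a decomposition \<open>r = j + s * f\<close> in which
  \<open>j\<close> involves only \<open>S\<close> and products avoiding \<open>f\<close>. The sets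
  \<open>T\<close> avoiding \<open>f\<close> then have \<open>s * f\<close>, and hence
  \<open>s\<close>, in their ideals. Induction over \<open>G\<close> writes \<open>s\<close> with
  products that are one factor too short, and \<open>f\<close> completes them.\<close>

lemma inter_eq_prods:
  assumes "finite F" "c \<le> card F"
    and "\<And>T f. T \<subseteq> F \<Longrightarrow> card T = c \<Longrightarrow> f \<in> F - T \<Longrightarrow> nonzerodivisor_mod f (S \<union> T)"
  shows "(\<Inter>T\<in>{T. T \<subseteq> F \<and> card T = c}. ideal_gen (S \<union> T))
    = ideal_gen (S \<union> {\<Prod>A |A. A \<subseteq> F \<and> card A = card F - c + 1})"
  using assms
proof (induction F arbitrary: c S)
  case empty
  then show ?case by auto
next
  case (insert f G)
  let ?P = "\<lambda>F m. {\<Prod>A |A. A \<subseteq> F \<and> card A = m}"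
  have [simp]: "card (insert f G) = Suc (card G)" using insert by simp
  have P_mono: "?P G m \<subseteq> ?P (insert f G) m" for m by auto
  have "r \<in> ideal_gen (S \<union> ?P (insert f G) (card (insert f G) - c + 1))"
    if r: "\<And>T. T \<subseteq> insert f G \<Longrightarrow> card T = c \<Longrightarrow> r \<in> ideal_gen (S \<union> T)" for r
  proof -
    \<comment> \<open>In the boundary cases, either only the empty set \<open>T\<close> occurs, or
      the products are single elements.\<close>
    consider "c = 0" | "c = Suc (card G)" | "0 < c" "c \<le> card G" using insert.prems(1) by force
    then show ?thesis
    proof cases
      case 1
      then show ?thesis using r[of "{}"] ideal_gen_mono[of S] by auto
    next
      case 2
      have "insert f G \<subseteq> ?P (insert f G) (card (insert f G) - c + 1)"
      proof
        fix x assume "x \<in> insert f G"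
        then show "x \<in> ?P (insert f G) (card (insert f G) - c + 1)"
          using 2 by (intro CollectI exI[of _ "{x}"]) auto
      qed
      then have "ideal_gen (S \<union> insert f G) \<subseteq> ideal_gen (S \<union> ?P (insert f G) (card (insert f G) - c + 1))"
        by (intro ideal_gen_mono Un_mono order_refl)
      moreover have "r \<in> ideal_gen (S \<union> insert f G)" using r[of "insert f G"] 2 by simp
      ultimately show ?thesis by (rule subsetD)
    next
      case 3
      \<comment> \<open>The length \<open>card G - (c - 1) + 1\<close> is the one required for
        \<open>insert f G\<close>: these are the wanted generators that avoid
        \<open>f\<close>.\<close>
      let ?J = "S \<union> ?P G (card G - (c - 1) + 1)"
      have IH1: "(\<Inter>T\<in>{T. T \<subseteq> G \<and> card T = c}. ideal_gen (S \<union> T)) = ideal_gen (S \<union> ?P G (card G - c + 1))"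
        using 3 insert.prems by (intro insert.IH) auto
      have IH2: "(\<Inter>T\<in>{T. T \<subseteq> G \<and> card T = c - 1}. ideal_gen (insert f S \<union> T)) = ideal_gen (insert f ?J)"
      proof (subst insert.IH)
        fix T g assume T: "T \<subseteq> G" "card T = c - 1" "g \<in> G - T"
        then have "finite T" "f \<notin> T" using insert.hyps finite_subset by auto
        then show "nonzerodivisor_mod g (insert f S \<union> T)"
          using insert.prems(2)[of "insert f T" g] T 3 insert.hyps by auto
      qed (use 3 in auto)
      have "r \<in> (\<Inter>T\<in>{T. T \<subseteq> G \<and> card T = c - 1}. ideal_gen (insert f S \<union> T))"
      proof clarsimp
        fix T assume T: "T \<subseteq> G" "card T = c - Suc 0"
        then have "finite T" "f \<notin> T" using insert.hyps finite_subset by auto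
        then show "r \<in> ideal_gen (insert f (S \<union> T))"
          using r[of "insert f T"] T 3 by auto
      qed
      then have "r \<in> ideal_gen (insert f ?J)" unfolding IH2 .
      then obtain j s where j: "j \<in> ideal_gen ?J" "r = j + s * f" by (rule ideal_gen_insertE)
      have J: "ideal_gen ?J \<subseteq> ideal_gen (S \<union> ?P (insert f G) (card (insert f G) - c + 1))"
      proof -
        have eq: "card (insert f G) - c = card G - (c - 1)" using 3 by simp
        show ?thesis unfolding eq by (intro ideal_gen_mono Un_mono order_refl P_mono)
      qed
      have "s \<in> ideal_gen (S \<union> T)" if T: "T \<subseteq> G" "card T = c" for T
      proof -
        have "j \<in> ideal_gen (S \<union> T)"
          using subsetD[OF J j(1)] prods_subset_inter[of "insert f G" c S] insert.hyps insert.prems(1) T by auto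
        moreover have "r \<in> ideal_gen (S \<union> T)" using r T by auto
        moreover have "s * f = r - j" using j(2) by simp
        ultimately have "s * f \<in> ideal_gen (S \<union> T)" by (simp only: ideal_gen_diff)
        moreover have "nonzerodivisor_mod f (S \<union> T)" using T insert by (intro insert.prems) auto
        ultimately show ?thesis by (rule nonzerodivisor_modD[rotated])
      qed
      then have "s \<in> ideal_gen (S \<union> ?P G (card G - c + 1))" unfolding IH1[symmetric] by auto
      then have "s * f \<in> ideal_gen (S \<union> ?P (insert f G) (card (insert f G) - c + 1))"
      proof (induction rule: ideal_gen_induct)
        case (step a p q)
        have "p * f \<in> ideal_gen (S \<union> ?P (insert f G) (card (insert f G) - c + 1))"
        proof (cases "p \<in> S")
          case True
          then show ?thesis by (intro ideal_gen_mult2 ideal_gen_base) auto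
        next
          case False
          then obtain A where A: "A \<subseteq> G" "card A = card G - c + 1" "p = \<Prod>A" using step by auto
          then have A': "finite A" "f \<notin> A" using insert.hyps finite_subset by auto
          then have "p * f = \<Prod>(insert f A)" "card (insert f A) = card (insert f G) - c + 1" "insert f A \<subseteq> insert f G"
            using A 3 by (auto simp: mult.commute)
          then have "p * f \<in> ?P (insert f G) (card (insert f G) - c + 1)" by blast
          then show ?thesis by (intro ideal_gen_base) auto
        qed
        then show ?case using step.IH
          by (simp add: distrib_right ideal_gen_add ideal_gen_mult mult.assoc)
      qed (simp add: ideal_gen_zero)
      then show ?thesis using j J by (auto intro: ideal_gen_add)
    qed
  qed
  then show ?case
    using prods_subset_inter[of "insert f G" c S] insert.hyps insert.prems(1) by (intro equalityI) auto
qed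

text \<open>\<open>card F - c + 1\<close> is the least size that forces a subset to meet every
  subset of size \<open>c\<close>.\<close>

definition star_gens :: "nat \<Rightarrow> 'a::comm_ring_1 set \<Rightarrow> 'a set" where
  "star_gens c F = {\<Prod>A |A. A \<subseteq> F \<and> card A = card F - c + 1}"

text \<open>In contrast to \<open>star_configuration\<close>, this still says something about \<open>F\<close> if
  \<open>c = card F\<close>: it then holds for regular sequences.\<close>

definition star_like :: "nat \<Rightarrow> ('v, 'k::field) mvpoly set \<Rightarrow> bool" where
  "star_like c F \<longleftrightarrow> finite F \<and> 1 \<le> c \<and> c \<le> card F \<and> (\<forall>f\<in>F. pos_homogeneous f) \<and>
     (\<forall>T f. T \<subseteq> F \<longrightarrow> card T \<le> c \<longrightarrow> f \<in> F - T \<longrightarrow> nonzerodivisor_mod f T)"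

lemma star_ideal_eq_prods:
  assumes "star_like c F"
  shows "star_ideal c F = ideal_gen (star_gens c F)"
  using inter_eq_prods[of F c "{}"] assms by (simp add: star_like_def star_ideal_def star_gens_def)

section \<open>Linear algebra over the field, and minimality via constant terms\<close>

lemma exists_null_combination:
  fixes c :: "'w \<Rightarrow> 'm \<Rightarrow> 'k::field"
  assumes "finite M" "finite W" "card M < card W"
  shows "\<exists>l. (\<exists>w\<in>W. l w \<noteq> 0) \<and> (\<forall>m\<in>M. (\<Sum>w\<in>W. l w * c w m) = 0)"
  using assms
proof (induction M arbitrary: W c)
  case empty
  then show ?case by (intro exI[of _ "\<lambda>_. 1"]) (auto simp: card_gt_0_iff)
next
  case (insert m M)
  show ?case
  proof (cases "\<exists>p\<in>W. c p m \<noteq> 0")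
    case False
    then show ?thesis using insert.IH[of W c] insert.hyps insert.prems by auto
  next
    case True
    then obtain p where p: "p \<in> W" "c p m \<noteq> 0" by auto
    have "\<exists>l. (\<exists>w\<in>W - {p}. l w \<noteq> 0) \<and>
        (\<forall>j\<in>M. (\<Sum>w\<in>W - {p}. l w * (c w j - c w m / c p m * c p j)) = 0)"
      using insert.hyps insert.prems p by (intro insert.IH) auto
    then obtain l where l: "\<exists>w\<in>W - {p}. l w \<noteq> 0"
      "\<And>j. j \<in> M \<Longrightarrow> (\<Sum>w\<in>W - {p}. l w * (c w j - c w m / c p m * c p j)) = 0" by auto
    \<comment> \<open>Equation \<open>m\<close> is solved for the pivot unknown \<open>p\<close>,
      which was eliminated from the other equations before the induction hypothesis was
      applied.\<close>
    define t where "t = - (\<Sum>w\<in>W - {p}. l w * c w m) / c p m"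
    have split: "(\<Sum>w\<in>W. (l(p := t)) w * c w j) = t * c p j + (\<Sum>w\<in>W - {p}. l w * c w j)" for j
      using p insert.prems by (subst sum.remove[of W p]) (auto intro!: sum.cong)
    have "(\<Sum>w\<in>W. (l(p := t)) w * c w j) = 0" if "j \<in> insert m M" for j
    proof (cases "j = m")
      case True
      then show ?thesis using p by (simp only: split) (simp add: t_def)
    next
      case False
      then have "0 = (\<Sum>w\<in>W - {p}. l w * c w j) - (\<Sum>w\<in>W - {p}. l w * c w m) / c p m * c p j"
        using l(2)[of j] that by (simp add: algebra_simps sum_subtractf sum_distrib_left sum_divide_distrib)
      then show ?thesis by (simp only: split) (simp add: t_def)
    qed
    then show ?thesis using l(1) by (intro exI[of _ "l(p := t)"]) auto
  qed
qed

text \<open>Linear independence of \<open>W\<close> modulo the irrelevant ideal times the ideal of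
  \<open>W\<close>, expressed through syzygies.\<close>

definition minimal_generators :: "('v, 'k::field) mvpoly set \<Rightarrow> bool" where
  "minimal_generators W \<longleftrightarrow> finite W \<and>
     (\<forall>a. (\<Sum>w\<in>W. a w * w) = 0 \<longrightarrow> (\<forall>w\<in>W. const_coeff (a w) = 0))"

lemma minimal_generators_unique:
  assumes "minimal_generators W" "(\<Sum>w\<in>W. a w * w) = (\<Sum>w\<in>W. b w * w)" "w \<in> W"
  shows "const_coeff (a w) = const_coeff (b w)"
proof -
  have "(\<Sum>w\<in>W. (a w - b w) * w) = 0" using assms(2) by (simp add: algebra_simps sum_subtractf)
  then have "const_coeff (a w - b w) = 0"
    using assms(1,3) by (auto simp: minimal_generators_def dest: spec[of _ "\<lambda>w. a w - b w"])
  then show ?thesis by (simp add: ring_map_simps[OF ring_map_const_coeff])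
qed

lemma const_coeff_single_0 [simp]: "const_coeff (Poly_Mapping.single 0 c) = c"
  by (simp add: const_coeff_def)

text \<open>Write \<open>W\<close> in terms of \<open>M\<close> and \<open>M\<close> in terms of
  \<open>W\<close>. If \<open>M\<close> were smaller, some nonzero scalar vector \<open>l\<close>
  would kill the constant terms of the first transition matrix. The combination of \<open>W\<close>
  with coefficients \<open>l\<close> would then equal one whose coefficients have constant term 0,
  against minimality.\<close>

lemma card_minimal_generators_le:
  fixes W M :: "('v, 'k::field) mvpoly set"
  assumes W: "minimal_generators W" and M: "finite M" "ideal_gen M = ideal_gen W"
  shows "card W \<le> card M"
proof (rule ccontr)
  assume "\<not> card W \<le> card M"
  have fin: "finite W" using W by (simp add: minimal_generators_def)
  have "\<exists>u. w = (\<Sum>m\<in>M. u m * m)" if "w \<in> W" for w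
    using ideal_gen_base[OF that] ideal_gen_finite[OF M(1)] M(2) by auto
  then obtain u where u: "\<And>w. w \<in> W \<Longrightarrow> w = (\<Sum>m\<in>M. u w m * m)" by metis
  have "\<exists>v. m = (\<Sum>w\<in>W. v w * w)" if "m \<in> M" for m
    using ideal_gen_base[OF that] ideal_gen_finite[OF fin] M(2) by auto
  then obtain v where v: "\<And>m. m \<in> M \<Longrightarrow> m = (\<Sum>w\<in>W. v m w * w)" by metis
  obtain l where l: "\<exists>w\<in>W. l w \<noteq> 0" "\<And>m. m \<in> M \<Longrightarrow> (\<Sum>w\<in>W. l w * const_coeff (u w m)) = 0"
    using exists_null_combination[OF M(1) fin, of "\<lambda>w m. const_coeff (u w m)"] \<open>\<not> card W \<le> card M\<close>
    by auto
  define e where "e m = (\<Sum>w\<in>W. Poly_Mapping.single 0 (l w) * u w m)" for m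
  have e: "const_coeff (e m) = 0" if "m \<in> M" for m
    using l(2)[OF that] by (simp add: e_def ring_map_simps[OF ring_map_const_coeff])
  have "(\<Sum>w\<in>W. Poly_Mapping.single 0 (l w) * w) =
      (\<Sum>w\<in>W. Poly_Mapping.single 0 (l w) * (\<Sum>m\<in>M. u w m * m))"
    by (rule sum.cong[OF refl]) (simp only: u[symmetric])
  also have "\<dots> = (\<Sum>m\<in>M. e m * m)"
    unfolding e_def sum_distrib_left sum_distrib_right by (subst sum.swap) (simp add: mult_ac)
  also have "\<dots> = (\<Sum>m\<in>M. e m * (\<Sum>w\<in>W. v m w * w))"
    by (rule sum.cong[OF refl]) (simp only: v[symmetric])
  also have "\<dots> = (\<Sum>w\<in>W. (\<Sum>m\<in>M. e m * v m w) * w)"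
    unfolding sum_distrib_left sum_distrib_right by (subst sum.swap) (simp add: mult_ac)
  finally have "l w = const_coeff (\<Sum>m\<in>M. e m * v m w)" if "w \<in> W" for w
    using minimal_generators_unique[OF W _ that, of "\<lambda>w. Poly_Mapping.single 0 (l w)"] by fastforce
  then have "l w = 0" if "w \<in> W" for w
    using that e by (simp add: ring_map_simps[OF ring_map_const_coeff])
  then show False using l(1) by auto
qed

lemma min_gens_minimal_generators:
  assumes "minimal_generators W"
  shows "min_gens (ideal_gen W) = card W"
  unfolding min_gens_def
  using assms card_minimal_generators_le by (intro Least_equality) (auto simp: minimal_generators_def)

text \<open>\<open>F - A\<close> has \<open>c - 1\<close> elements, so every factor of
  \<open>\<Prod>A\<close> can be cancelled modulo it. This leaves \<open>r\<close> in an ideal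
  generated by forms of positive degree.\<close>

lemma const_coeff_eq_0_of_mult_prod:
  assumes star: "star_like c F" and A: "A \<subseteq> F" "card A = card F - c + 1"
    and r: "r * \<Prod>A \<in> ideal_gen (F - A)"
  shows "const_coeff r = 0"
proof -
  have "finite A" "card A \<le> card F" using star A by (auto simp: star_like_def intro: finite_subset card_mono)
  then have "card (F - A) \<le> c" using star A by (auto simp: star_like_def card_Diff_subset)
  then have "nonzerodivisor_mod f (F - A)" if "f \<in> A" for f
    using star A that by (auto simp: star_like_def)
  then have "r \<in> ideal_gen (F - A)"
    using nonzerodivisor_mod_prod[of A "\<lambda>x. x" "F - A" r] r by auto
  then show ?thesis
    using star by (rule_tac ring_map_ideal_gen_eq_0[OF ring_map_const_coeff])
      (auto simp: star_like_def const_coeff_pos_homogeneous)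
qed

text \<open>\<open>B\<close> has a factor outside \<open>A\<close>. Hence all generators other than
  \<open>\<Prod>A\<close> vanish modulo \<open>F - A\<close>, which isolates one coefficient of a
  syzygy.\<close>

lemma prod_in_ideal_gen_complement:
  assumes "finite F" "A \<subseteq> F" "B \<subseteq> F" "card A = card B" "A \<noteq> B"
  shows "\<Prod>B \<in> ideal_gen (F - A)"
proof -
  have "finite A" "finite B" using assms finite_subset by auto
  then obtain f where f: "f \<in> B" "f \<notin> A" using assms(4,5) by (metis card_subset_eq subsetI)
  have "\<Prod>B = \<Prod>(B - {f}) * f" using \<open>finite B\<close> f by (simp add: prod.remove mult.commute)
  moreover have "f \<in> ideal_gen (F - A)" using f assms by (auto intro: ideal_gen_base)
  ultimately show ?thesis by (simp only: ideal_gen_mult)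
qed

text \<open>\<open>star_gens\<close> is a set, so counting it requires distinct products. A
  coincidence would put \<open>1 * \<Prod>A\<close> into the ideal of \<open>F - A\<close>, and 1
  would have constant term 0.\<close>

lemma star_gens_inj:
  fixes F :: "('v, 'k::field) mvpoly set"
  assumes "star_like c F"
  shows "inj_on (\<lambda>A. \<Prod>A) {A. A \<subseteq> F \<and> card A = card F - c + 1}"
proof (rule inj_onI, rule ccontr)
  fix A B assume A: "A \<in> {A. A \<subseteq> F \<and> card A = card F - c + 1}"
    and B: "B \<in> {A. A \<subseteq> F \<and> card A = card F - c + 1}" and eq: "\<Prod>A = \<Prod>B" "A \<noteq> B"
  have "\<Prod>B \<in> ideal_gen (F - A)"
    using A B eq assms by (intro prod_in_ideal_gen_complement) (auto simp: star_like_def)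
  then have "1 * \<Prod>A \<in> ideal_gen (F - A)" using eq by simp
  then have "const_coeff (1 :: ('v, 'k) mvpoly) = 0"
    using assms A by (intro const_coeff_eq_0_of_mult_prod) auto
  then show False by (simp add: ring_map_simps[OF ring_map_const_coeff])
qed

lemma star_gens_eq_image: "star_gens c F = (\<lambda>A. \<Prod>A) ` {A. A \<subseteq> F \<and> card A = card F - c + 1}"
  by (auto simp: star_gens_def)

lemma card_star_gens:
  fixes F :: "('v, 'k::field) mvpoly set"
  assumes "star_like c F"
  shows "card (star_gens c F) = card F choose (c - 1)"
proof -
  have "card (star_gens c F) = card F choose (card F - c + 1)"
    using assms unfolding star_gens_eq_image
    by (subst card_image[OF star_gens_inj[OF assms]]) (simp add: n_subsets star_like_def)
  also have "\<dots> = card F choose (card F - (card F - c + 1))"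
    using assms by (intro binomial_symmetric) (auto simp: star_like_def)
  also have "card F - (card F - c + 1) = c - 1" using assms by (auto simp: star_like_def)
  finally show ?thesis .
qed

lemma minimal_generators_star_gens:
  fixes F :: "('v, 'k::field) mvpoly set"
  assumes star: "star_like c F"
  shows "minimal_generators (star_gens c F)"
  unfolding minimal_generators_def
proof (intro conjI allI impI ballI)
  let ?I = "{A. A \<subseteq> F \<and> card A = card F - c + 1}"
  have "finite F" using star by (simp add: star_like_def)
  then have fin: "finite ?I" by (intro finite_subset[of ?I "Pow F"]) auto
  then show "finite (star_gens c F)" by (simp add: star_gens_eq_image)
  fix a w assume 0: "(\<Sum>w\<in>star_gens c F. a w * w) = 0" and "w \<in> star_gens c F"
  then obtain A where A: "A \<in> ?I" "w = \<Prod>A" by (auto simp: star_gens_def)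
  have "0 = (\<Sum>B\<in>?I. a (\<Prod>B) * \<Prod>B)"
    using 0 star_gens_inj[OF star] by (simp add: star_gens_eq_image sum.reindex)
  also have "\<dots> = a w * \<Prod>A + (\<Sum>B\<in>?I - {A}. a (\<Prod>B) * \<Prod>B)"
    using A fin by (simp add: sum.remove)
  finally have "a w * \<Prod>A = 0 - (\<Sum>B\<in>?I - {A}. a (\<Prod>B) * \<Prod>B)"
    by (simp add: eq_neg_iff_add_eq_0)
  also have "\<dots> \<in> ideal_gen (F - A)"
    using A \<open>finite F\<close>
    by (intro ideal_gen_diff ideal_gen_zero ideal_gen_sum ideal_gen_mult prod_in_ideal_gen_complement) auto
  finally show "const_coeff (a w) = 0"
    using A star by (intro const_coeff_eq_0_of_mult_prod) auto
qed

lemma min_gens_star_ideal: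
  assumes "star_like c F"
  shows "min_gens (star_ideal c F) = card F choose (c - 1)"
  using assms by (simp add: star_ideal_eq_prods min_gens_minimal_generators
      minimal_generators_star_gens card_star_gens)

section \<open>The Rees map\<close>

lemma ring_map_pCons: "ring_map (\<lambda>c. [:c:])"
  by (simp add: ring_map_def pCons_one)

lemma rees_map_eq_eval: "rees_map gs = eval_poly (\<lambda>c. [:c:]) (\<lambda>i. Polynomial.monom (gs ! i) 1)"
  by (rule ext) (simp add: rees_map_def eval_poly_def eval_monom_def)

lemma eval_monom_monom:
  fixes u :: "'i \<Rightarrow>\<^sub>0 nat"
  shows "eval_monom (\<lambda>i. Polynomial.monom (g i) 1) u = Polynomial.monom (eval_monom g u) (monom_degree u)"
proof -
  have "(\<Prod>i\<in>A. Polynomial.monom (g i) 1 ^ n i) = Polynomial.monom (\<Prod>i\<in>A. g i ^ n i) (\<Sum>i\<in>A. n i)"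
    if "finite A" for A and n :: "'i \<Rightarrow> nat"
    using that by (induction A) (auto simp: monom_power mult_monom)
  then show ?thesis by (simp add: eval_monom_def monom_degree_def)
qed

lemma eval_poly_degree_part:
  assumes "ring_map \<phi>"
  shows "eval_poly \<phi> v (degree_part d P) =
    (\<Sum>u\<in>{u\<in>Poly_Mapping.keys P. monom_degree u = d}. \<phi> (Poly_Mapping.lookup P u) * eval_monom v u)"
  by (simp add: degree_part_def eval_poly_sum[OF assms] eval_poly_single[OF assms])

text \<open>The power of the Rees variable records the degree in the \<open>T\<close> variables, so
  membership in the kernel can be tested on each homogeneous part.\<close>

lemma coeff_rees_map: "poly.coeff (rees_map gs P) d = eval_poly (\<lambda>x. x) (\<lambda>i. gs ! i) (degree_part d P)"
proof -
  have "poly.coeff (rees_map gs P) d =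
    (\<Sum>u\<in>Poly_Mapping.keys P. if monom_degree u = d then Poly_Mapping.lookup P u * eval_monom ((!) gs) u else 0)"
    unfolding rees_map_eq_eval eval_poly_def eval_monom_monom
    by (auto simp: coeff_sum intro!: sum.cong)
  also have "\<dots> = eval_poly (\<lambda>x. x) (\<lambda>i. gs ! i) (degree_part d P)"
    by (simp add: eval_poly_degree_part[OF ring_map_id] sum.If_cases Int_def)
  finally show ?thesis .
qed

lemma ring_map_rees_map: "ring_map (rees_map gs)"
  by (simp add: rees_map_eq_eval ring_map_eval_poly ring_map_pCons)

section \<open>The subring \<open>T_polys\<close> as a retract of the full polynomial ring\<close>

definition var :: "'i \<Rightarrow> ('i, 'a::comm_ring_1) mvpoly" where
  "var i = Poly_Mapping.single (Poly_Mapping.single i 1) 1"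

definition truncate_vars :: "nat \<Rightarrow> (nat, 'a::comm_ring_1) mvpoly \<Rightarrow> (nat, 'a) mvpoly" where
  "truncate_vars m = eval_poly (Poly_Mapping.single 0)
     (\<lambda>i. if i < m then var i else 0)"

lemma ring_map_truncate_vars: "ring_map (truncate_vars m)"
  by (simp add: truncate_vars_def ring_map_eval_poly ring_map_single_0)

lemma eval_monom_vars:
  "eval_monom var u = Poly_Mapping.single u (1 :: 'a::comm_ring_1)"
proof -
  have pow: "(var i :: ('b, 'a) mvpoly) ^ k = Poly_Mapping.single (Poly_Mapping.single i k) 1" for i :: 'b and k :: nat
    by (induction k) (simp_all add: var_def mult_single flip: single_add)
  have "(\<Prod>i\<in>A. Poly_Mapping.single (Poly_Mapping.single i (n i)) (1 :: 'a))
      = Poly_Mapping.single (\<Sum>i\<in>A. Poly_Mapping.single i (n i)) 1" if "finite A"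
    for A and n :: "'b \<Rightarrow> nat"
    using that by (induction A) (auto simp: mult_single)
  then show ?thesis
    using poly_mapping_sum_single[of "Poly_Mapping.keys u" u] by (simp add: eval_monom_def pow)
qed

lemma eval_monom_cong: "(\<And>i. i \<in> Poly_Mapping.keys u \<Longrightarrow> v i = w i) \<Longrightarrow> eval_monom v u = eval_monom w u"
  by (simp add: eval_monom_def)

lemma truncate_vars_id:
  assumes "P \<in> T_polys m"
  shows "truncate_vars m P = P"
proof -
  have "truncate_vars m P = (\<Sum>u\<in>Poly_Mapping.keys P. Poly_Mapping.single u (Poly_Mapping.lookup P u))"
    unfolding truncate_vars_def eval_poly_def
  proof (rule sum.cong[OF refl])
    fix u assume "u \<in> Poly_Mapping.keys P"
    then have "Poly_Mapping.keys u \<subseteq> {..<m}" using assms by (auto simp: T_polys_def)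
    then have "eval_monom (\<lambda>i. if i < m then var i else 0) u
        = (eval_monom var u :: (nat, 'a) mvpoly)"
      by (intro eval_monom_cong) auto
    then show "Poly_Mapping.single 0 (Poly_Mapping.lookup P u) *
        eval_monom (\<lambda>i. if i < m then var i else 0) u
        = Poly_Mapping.single u (Poly_Mapping.lookup P u)"
      by (simp add: eval_monom_vars mult_single)
  qed
  then show ?thesis using poly_mapping_sum_single[of "Poly_Mapping.keys P" P] by simp
qed

lemma T_polys_add: "P \<in> T_polys m \<Longrightarrow> Q \<in> T_polys m \<Longrightarrow> P + Q \<in> T_polys m"
  using keys_add[of P Q] by (force simp: T_polys_def)

lemma T_polys_mult: "P \<in> T_polys m \<Longrightarrow> Q \<in> T_polys m \<Longrightarrow> P * Q \<in> T_polys m"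
proof -
  assume PQ: "P \<in> T_polys m" "Q \<in> T_polys m"
  have "Poly_Mapping.keys (a + b) \<subseteq> {..<m}" if "a \<in> Poly_Mapping.keys P" "b \<in> Poly_Mapping.keys Q" for a b
    using PQ that keys_add[of a b] by (fastforce simp: T_polys_def)
  then show ?thesis using keys_mult[of P Q] by (fastforce simp: T_polys_def)
qed

lemma T_polys_single: "Poly_Mapping.keys u \<subseteq> {..<m} \<Longrightarrow> Poly_Mapping.single u c \<in> T_polys m"
  by (simp add: T_polys_def)

lemma T_polys_0: "0 \<in> T_polys m" and T_polys_1: "1 \<in> T_polys m"
  by (simp_all add: T_polys_def)

lemma T_polys_sum: "(\<And>x. x \<in> A \<Longrightarrow> f x \<in> T_polys m) \<Longrightarrow> sum f A \<in> T_polys m"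
  by (induction A rule: infinite_finite_induct) (auto intro: T_polys_add T_polys_0)

lemma T_polys_prod: "(\<And>x. x \<in> A \<Longrightarrow> f x \<in> T_polys m) \<Longrightarrow> prod f A \<in> T_polys m"
  by (induction A rule: infinite_finite_induct) (auto intro: T_polys_mult T_polys_1)

lemma T_polys_power: "f \<in> T_polys m \<Longrightarrow> f ^ k \<in> T_polys m"
  by (induction k) (auto intro: T_polys_mult T_polys_1)

lemma truncate_vars_in_T_polys: "truncate_vars m P \<in> T_polys m"
  unfolding truncate_vars_def eval_poly_def eval_monom_def
  by (intro T_polys_sum T_polys_mult T_polys_prod T_polys_power)
    (auto simp: var_def intro: T_polys_single T_polys_0)

text \<open>\<open>truncate_vars m\<close> fixes \<open>T_polys m\<close>, so applied to a
  combination of elements of \<open>L\<close> it moves arbitrary coefficients into the subring.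
  Later arguments can thus use ordinary ideals.\<close>

lemma ideal_gen_in_T_polys:
  assumes "L \<subseteq> T_polys m"
  shows "ideal_gen_in (T_polys m) L = ideal_gen L \<inter> T_polys m"
proof
  show "ideal_gen_in (T_polys m) L \<subseteq> ideal_gen L \<inter> T_polys m"
  proof
    fix P assume "P \<in> ideal_gen_in (T_polys m) L"
    then obtain a B where B: "P = (\<Sum>s\<in>B. a s * s)" "B \<subseteq> L" "a ` B \<subseteq> T_polys m"
      by (auto simp: ideal_gen_in_def)
    have "P \<in> ideal_gen L" unfolding B(1)
      using B(2) by (intro ideal_gen_sum ideal_gen_mult ideal_gen_base) auto
    moreover have "P \<in> T_polys m" unfolding B(1)
      using B(2,3) assms by (intro T_polys_sum T_polys_mult) auto
    ultimately show "P \<in> ideal_gen L \<inter> T_polys m" by simp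
  qed
  show "ideal_gen L \<inter> T_polys m \<subseteq> ideal_gen_in (T_polys m) L"
  proof
    fix P assume P: "P \<in> ideal_gen L \<inter> T_polys m"
    then obtain B a where B: "finite B" "B \<subseteq> L" "P = (\<Sum>s\<in>B. a s * s)"
      by (auto simp: ideal_gen_explicit)
    have "P = truncate_vars m P" using P by (simp add: truncate_vars_id)
    also have "\<dots> = (\<Sum>s\<in>B. truncate_vars m (a s) * s)"
      unfolding B(3) ring_map_simps[OF ring_map_truncate_vars]
      using B(2) assms by (intro sum.cong refl arg_cong2[where f = "(*)"] truncate_vars_id) auto
    finally show "P \<in> ideal_gen_in (T_polys m) L"
      unfolding ideal_gen_in_def using B truncate_vars_in_T_polys
      by (intro CollectI exI[of _ "\<lambda>s. truncate_vars m (a s)"] exI[of _ B]) auto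
  qed
qed

lemma lookup_single_mult: "Poly_Mapping.lookup (Poly_Mapping.single u c * p) (u + v) = c * Poly_Mapping.lookup p v"
  for p :: "('i, 'a::comm_ring_1) mvpoly"
proof -
  have "Poly_Mapping.single u c * p =
      Poly_Mapping.single u c * (\<Sum>w\<in>Poly_Mapping.keys p. Poly_Mapping.single w (Poly_Mapping.lookup p w))"
    using poly_mapping_sum_single[of "Poly_Mapping.keys p" p] by simp
  then show ?thesis
    by (simp add: sum_distrib_left mult_single lookup_sum lookup_single when_def in_keys_iff)
qed

lemma single_mult_eq_0:
  fixes p :: "('i, 'a::comm_ring_1) mvpoly"
  assumes "Poly_Mapping.single u 1 * p = 0"
  shows "p = 0"
  using lookup_single_mult[of u 1 p] assms by (intro poly_mapping_eqI) simp

text \<open>Coefficients are attached to positions because \<open>gs\<close> may repeat an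
  element.\<close>

lemma ideal_gen_list_combination:
  assumes "r \<in> ideal_gen (set gs)"
  shows "\<exists>a. r = (\<Sum>j<length gs. a j * gs ! j)"
  using assms
proof (induction rule: ideal_gen_induct)
  case base
  show ?case by (intro exI[of _ "\<lambda>_. 0"]) simp
next
  case (step c x y)
  then obtain a i where a: "y = (\<Sum>j<length gs. a j * gs ! j)" and i: "i < length gs" "gs ! i = x"
    by (auto simp: in_set_conv_nth)
  have "(\<Sum>j<length gs. (if j = i then c else 0) * gs ! j) = (\<Sum>j<length gs. if j = i then c * gs ! j else 0)"
    by (rule sum.cong) auto
  then have "c * x + y = (\<Sum>j<length gs. ((if j = i then c else 0) + a j) * gs ! j)"
    using i by (simp add: a distrib_right sum.distrib)
  then show ?case by (rule exI[of _ "\<lambda>j. (if j = i then c else 0) + a j"])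
qed

section \<open>Linear type bounds the number of generators\<close>

text \<open>The exponent of one chosen variable is determined by the total degree, and each of the
  other exponents is at most \<open>D\<close>.\<close>

lemma card_monomials_of_degree:
  shows "finite {u :: 'v::finite \<Rightarrow>\<^sub>0 nat. monom_degree u = D}"
    and "card {u :: 'v \<Rightarrow>\<^sub>0 nat. monom_degree u = D} \<le> (D + 1) ^ (CARD('v) - 1)"
proof -
  let ?M = "{u :: 'v \<Rightarrow>\<^sub>0 nat. monom_degree u = D}"
  fix x :: 'v
  let ?E = "PiE (UNIV - {x}) (\<lambda>_. {..D})"
  let ?r = "\<lambda>u :: 'v \<Rightarrow>\<^sub>0 nat. restrict (Poly_Mapping.lookup u) (UNIV - {x})"
  have deg: "monom_degree u = Poly_Mapping.lookup u x + (\<Sum>i\<in>UNIV - {x}. Poly_Mapping.lookup u i)" for u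
    by (simp add: monom_degree_superset[of UNIV] sum.remove)
  have into: "?r ` ?M \<subseteq> ?E"
  proof
    fix g assume "g \<in> ?r ` ?M"
    then obtain u where u: "monom_degree u = D" "g = ?r u" by auto
    have "Poly_Mapping.lookup u i \<le> D" if "i \<noteq> x" for i
      using u(1) that member_le_sum[of i "UNIV - {x}" "Poly_Mapping.lookup u"] unfolding deg by simp
    then show "g \<in> ?E" using u by auto
  qed
  have inj: "inj_on ?r ?M"
  proof (rule inj_onI)
    fix u w assume u: "u \<in> ?M" and w: "w \<in> ?M" and eq: "?r u = ?r w"
    have neq: "Poly_Mapping.lookup u i = Poly_Mapping.lookup w i" if "i \<noteq> x" for i
      using fun_cong[OF eq, of i] that by simp
    then have "(\<Sum>i\<in>UNIV - {x}. Poly_Mapping.lookup u i) = (\<Sum>i\<in>UNIV - {x}. Poly_Mapping.lookup w i)"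
      by (intro sum.cong) auto
    then have "Poly_Mapping.lookup u x = Poly_Mapping.lookup w x"
      using u w deg[of u] deg[of w] by simp
    with neq show "u = w" by (intro poly_mapping_eqI) metis
  qed
  have E: "finite ?E" "card ?E = (D + 1) ^ (CARD('v) - 1)"
    by (auto intro: finite_PiE simp: card_PiE card_Diff_subset)
  show "finite ?M" using inj into E(1) by (rule inj_on_finite)
  show "card ?M \<le> (D + 1) ^ (CARD('v) - 1)"
    using card_inj_on_le[OF inj into E(1)] E(2) by simp
qed

lemma monom_degree_sum: "monom_degree (sum f A) = (\<Sum>x\<in>A. monom_degree (f x))"
  by (induction A rule: infinite_finite_induct) (auto simp: monom_degree_add)

lemma homogeneous_eval_monom:
  fixes v :: "'i \<Rightarrow> ('v, 'k::comm_ring_1) mvpoly"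
  assumes "\<And>i. i \<in> Poly_Mapping.keys u \<Longrightarrow> homogeneous_of_degree (d i) (v i)"
  shows "homogeneous_of_degree (\<Sum>i\<in>Poly_Mapping.keys u. Poly_Mapping.lookup u i * d i) (eval_monom v u)"
  unfolding eval_monom_def
  by (intro homogeneous_of_degree_prod homogeneous_of_degree_power assms)

text \<open>The exponents of the \<open>p\<close> elements other than \<open>w0\<close> are chosen
  freely below \<open>m\<close>. Their sum is at most \<open>p * m\<close>, and \<open>w0\<close>
  absorbs the difference.\<close>

lemma many_monomials_of_degree:
  assumes "finite W" "w0 \<in> W" "card W = Suc p"
  obtains \<Phi> where "finite \<Phi>" "card \<Phi> = m ^ p"
    "\<And>f. f \<in> \<Phi> \<Longrightarrow> Poly_Mapping.keys f \<subseteq> W \<and> monom_degree f = p * m"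
proof -
  let ?W = "W - {w0}" and ?N = "p * m"
  have card: "card ?W = p" using assms by simp
  let ?G = "PiE ?W (\<lambda>_. {..<m})"
  define h where "h g = (\<Sum>w\<in>?W. Poly_Mapping.single w (g w)) + Poly_Mapping.single w0 (?N - sum g ?W)" for g
  have look: "Poly_Mapping.lookup (h g) w = g w" if "w \<in> ?W" for g w
    using that assms by (auto simp: h_def lookup_add lookup_sum lookup_single when_def)
  have "inj_on h ?G"
  proof (rule inj_onI)
    fix g g' assume g: "g \<in> ?G" "g' \<in> ?G" "h g = h g'"
    have "g w = g' w" if "w \<in> ?W" for w
      using look[OF that, of g] look[OF that, of g'] g(3) by simp
    with g(1,2) show "g = g'" by (rule PiE_ext)
  qed
  then have "card (h ` ?G) = m ^ p" using assms card by (simp add: card_image card_PiE)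
  moreover have "finite (h ` ?G)" using assms by (intro finite_imageI finite_PiE) auto
  moreover have "Poly_Mapping.keys f \<subseteq> W \<and> monom_degree f = ?N" if "f \<in> h ` ?G" for f
  proof -
    from that obtain g where g: "g \<in> ?G" "f = h g" by blast
    have "g w \<le> m" if "w \<in> ?W" for w using PiE_mem[OF g(1) that] by simp
    then have "sum g ?W \<le> (\<Sum>w\<in>?W. m)" by (rule sum_mono)
    then have le: "sum g ?W \<le> ?N" using card by simp
    have "Poly_Mapping.keys f \<subseteq> W"
    proof
      fix w assume w: "w \<in> Poly_Mapping.keys f"
      show "w \<in> W"
      proof (rule ccontr)
        assume "w \<notin> W"
        then have "Poly_Mapping.lookup f w = 0"
          using assms by (auto simp: g(2) h_def lookup_add lookup_sum lookup_single when_def intro!: sum.neutral)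
        then show False using w by (simp add: in_keys_iff)
      qed
    qed
    moreover have "monom_degree f = ?N" using le by (simp add: g(2) h_def monom_degree_add monom_degree_sum)
    ultimately show ?thesis by simp
  qed
  ultimately show ?thesis using that by blast
qed

text \<open>As functions of \<open>m\<close>, the left side grows with exponent \<open>n - 1\<close>
  and the right side with \<open>p \<ge> n\<close>. In the application \<open>p * m * b\<close> is
  the common degree of the padded products and \<open>m ^ p\<close> their number.\<close>

lemma counting_bound:
  fixes n p b :: nat
  assumes "1 \<le> n" "n \<le> p"
  shows "\<exists>m. (p * m * b + 1) ^ (n - 1) < m ^ p"
proof -
  define C where "C = p * b + 1"
  \<comment> \<open>Once \<open>(C * m) ^ (n - 1)\<close> is split into two powers, \<open>m\<close>
    only has to exceed \<open>C ^ (n - 1)\<close>.\<close>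
  define m where "m = C ^ (n - 1) + 1"
  have "p * m * b + 1 \<le> C * m" by (simp add: C_def m_def algebra_simps)
  then have "(p * m * b + 1) ^ (n - 1) \<le> (C * m) ^ (n - 1)" by (intro power_mono) auto
  also have "\<dots> = C ^ (n - 1) * m ^ (n - 1)" by (simp add: power_mult_distrib)
  also have "\<dots> < m * m ^ (n - 1)" by (simp add: m_def)
  also have "\<dots> = m ^ n" using assms by (cases n) auto
  also have "\<dots> \<le> m ^ p" using assms by (intro power_increasing) (auto simp: m_def)
  finally show ?thesis by blast
qed

text \<open>The monomials of degree \<open>N\<close> in the elements of \<open>W\<close>, multiplied by powers of a variable
  to bring them to a common degree, outnumber the monomials of that degree in \<open>CARD('v)\<close> variables.
  The smallest of those powers can be cancelled from a linear relation.\<close>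

lemma exists_monomial_relation:
  fixes W :: "('v::finite, 'k::field) mvpoly set" and x :: 'v
  assumes W: "finite W" "\<forall>w\<in>W. homogeneous w" "CARD('v) < card W"
  obtains \<Phi> :: "(('v, 'k) mvpoly \<Rightarrow>\<^sub>0 nat) set" and l :: "(('v, 'k) mvpoly \<Rightarrow>\<^sub>0 nat) \<Rightarrow> 'k" and e N
  where "finite \<Phi>" "\<And>f. f \<in> \<Phi> \<Longrightarrow> Poly_Mapping.keys f \<subseteq> W \<and> monom_degree f = N \<and> l f \<noteq> 0"
    "\<exists>f\<in>\<Phi>. e f = 0"
    "(\<Sum>f\<in>\<Phi>. Poly_Mapping.single (Poly_Mapping.single x (e f)) (l f) * eval_monom (\<lambda>w. w) f) = 0"
proof -
  obtain p where p: "card W = Suc p" "CARD('v) \<le> p" using W(3) by (cases "card W") auto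
  then obtain w0 where w0: "w0 \<in> W" by fastforce
  obtain d where d: "\<And>w. w \<in> W \<Longrightarrow> homogeneous_of_degree (d w) w"
    using W(2) unfolding homogeneous_def by metis
  \<comment> \<open>The sum of the degrees serves as a crude common bound.\<close>
  define b where "b = sum d W"
  have db: "d w \<le> b" if "w \<in> W" for w using that W(1) by (simp add: b_def member_le_sum)
  have "1 \<le> CARD('v)" by (simp add: Suc_leI)
  from counting_bound[OF this p(2)] obtain m where m: "(p * m * b + 1) ^ (CARD('v) - 1) < m ^ p" by blast
  obtain \<Phi>0 where \<Phi>0: "finite \<Phi>0" "card \<Phi>0 = m ^ p"
    "\<And>f. f \<in> \<Phi>0 \<Longrightarrow> Poly_Mapping.keys f \<subseteq> W \<and> monom_degree f = p * m"
    using many_monomials_of_degree[OF W(1) w0 p(1)] by metis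
  \<comment> \<open>A product of \<open>p * m\<close> forms of degree at most \<open>b\<close> has
    at most this degree, so it can be padded up to it.\<close>
  let ?D = "p * m * b"
  let ?M = "{u :: 'v \<Rightarrow>\<^sub>0 nat. monom_degree u = ?D}"
  define deg where "deg f = (\<Sum>w\<in>Poly_Mapping.keys f. Poly_Mapping.lookup f w * d w)"
    for f :: "('v, 'k) mvpoly \<Rightarrow>\<^sub>0 nat"
  have deg_le: "deg f \<le> ?D" if "f \<in> \<Phi>0" for f
  proof -
    have "deg f \<le> (\<Sum>w\<in>Poly_Mapping.keys f. Poly_Mapping.lookup f w * b)"
      unfolding deg_def using \<Phi>0(3)[OF that] db by (intro sum_mono mult_left_mono) auto
    also have "\<dots> = ?D" using \<Phi>0(3)[OF that] by (simp add: monom_degree_def flip: sum_distrib_right)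
    finally show ?thesis .
  qed
  define E where "E f = ?D - deg f" for f
  define P where "P f = Poly_Mapping.single (Poly_Mapping.single x (E f)) 1 * eval_monom (\<lambda>w. w) f" for f
  have P: "homogeneous_of_degree ?D (P f)" if "f \<in> \<Phi>0" for f
  proof -
    have "homogeneous_of_degree (E f + deg f) (P f)" unfolding P_def deg_def
      using \<Phi>0(3)[OF that] d by (intro homogeneous_of_degree_mult homogeneous_eval_monom) auto
    then show ?thesis using deg_le[OF that] by (simp add: E_def)
  qed
  have "card ?M < card \<Phi>0" using card_monomials_of_degree(2)[where 'v='v, of ?D] m \<Phi>0(2) by simp
  then obtain l where l: "\<exists>f\<in>\<Phi>0. l f \<noteq> 0"
    "\<And>u. u \<in> ?M \<Longrightarrow> (\<Sum>f\<in>\<Phi>0. l f * Poly_Mapping.lookup (P f) u) = 0"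
    using exists_null_combination[OF card_monomials_of_degree(1) \<Phi>0(1), of ?D "\<lambda>f. Poly_Mapping.lookup (P f)"]
    by auto
  have "(\<Sum>f\<in>\<Phi>0. Poly_Mapping.single 0 (l f) * P f) = 0"
  proof (rule poly_mapping_eqI)
    fix u
    have "Poly_Mapping.lookup (Poly_Mapping.single 0 (l f) * P f) u = l f * Poly_Mapping.lookup (P f) u" for f
      using lookup_single_mult[of 0 "l f" "P f" u] by simp
    moreover have "Poly_Mapping.lookup (P f) u = 0" if "u \<notin> ?M" "f \<in> \<Phi>0" for f
      using P[OF that(2)] that(1) by (auto simp: homogeneous_of_degree_def in_keys_iff)
    ultimately show "Poly_Mapping.lookup (\<Sum>f\<in>\<Phi>0. Poly_Mapping.single 0 (l f) * P f) u = Poly_Mapping.lookup 0 u"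
      using l(2)[of u] by (cases "u \<in> ?M") (simp_all add: lookup_sum)
  qed
  \<comment> \<open>Zero coefficients are discarded first, so that the term with the least padding
    has a nonzero one.\<close>
  moreover define \<Phi> where "\<Phi> = {f \<in> \<Phi>0. l f \<noteq> 0}"
  ultimately have rel: "(\<Sum>f\<in>\<Phi>. Poly_Mapping.single 0 (l f) * P f) = 0"
    using \<Phi>0(1) by (subst (asm) sum.mono_neutral_right[of \<Phi>0 \<Phi>]) auto
  have \<Phi>: "finite \<Phi>" "\<Phi> \<noteq> {}" using \<Phi>0(1) l(1) by (auto simp: \<Phi>_def)
  define e0 where "e0 = Min (E ` \<Phi>)"
  have e0: "e0 \<le> E f" if "f \<in> \<Phi>" for f using that \<Phi> by (simp add: e0_def)
  have "e0 \<in> E ` \<Phi>" using \<Phi> unfolding e0_def by (intro Min_in) auto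
  then have ex: "\<exists>f\<in>\<Phi>. E f - e0 = 0" by auto
  have "Poly_Mapping.single (Poly_Mapping.single x e0) 1 *
      (\<Sum>f\<in>\<Phi>. Poly_Mapping.single (Poly_Mapping.single x (E f - e0)) (l f) * eval_monom (\<lambda>w. w) f) =
      (\<Sum>f\<in>\<Phi>. Poly_Mapping.single 0 (l f) * P f)"
    unfolding sum_distrib_left P_def
    by (rule sum.cong[OF refl]) (use e0 in \<open>simp add: mult_single flip: mult.assoc single_add\<close>)
  then have "(\<Sum>f\<in>\<Phi>. Poly_Mapping.single (Poly_Mapping.single x (E f - e0)) (l f) * eval_monom (\<lambda>w. w) f) = 0"
    unfolding rel by (rule single_mult_eq_0)
  then show ?thesis
    using \<Phi>0(3) \<Phi>(1) ex by (intro that[of \<Phi> "p * m" l "\<lambda>f. E f - e0"]) (auto simp: \<Phi>_def)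
qed

lemma eval_monom_ring_map: "ring_map \<phi> \<Longrightarrow> \<phi> (eval_monom v u) = eval_monom (\<lambda>i. \<phi> (v i)) u"
  by (simp add: eval_monom_def ring_map_simps)

lemma T_polys_linear:
  assumes "P \<in> T_polys m" "homogeneous_of_degree 1 P"
  shows "P = (\<Sum>j<m. Poly_Mapping.single 0 (Poly_Mapping.lookup P (Poly_Mapping.single j 1)) * var j)"
proof -
  let ?s = "\<lambda>j :: nat. Poly_Mapping.single j (1 :: nat)"
  have "Poly_Mapping.keys P \<subseteq> ?s ` {..<m}"
  proof
    fix u assume u: "u \<in> Poly_Mapping.keys P"
    then have deg: "monom_degree u = 1" and sub: "Poly_Mapping.keys u \<subseteq> {..<m}"
      using assms by (auto simp: homogeneous_of_degree_def T_polys_def)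
    then obtain j where j: "j \<in> Poly_Mapping.keys u" by (metis monom_degree_0 all_not_in_conv keys_eq_empty zero_neq_one)
    then have "monom_degree u = Poly_Mapping.lookup u j + (\<Sum>i\<in>Poly_Mapping.keys u - {j}. Poly_Mapping.lookup u i)"
      by (simp add: monom_degree_def sum.remove)
    moreover have "Poly_Mapping.lookup u j > 0" using j by (simp add: in_keys_iff)
    ultimately have 1: "Poly_Mapping.lookup u j = 1"
      and 0: "(\<Sum>i\<in>Poly_Mapping.keys u - {j}. Poly_Mapping.lookup u i) = 0" using deg by linarith+
    have "u = ?s j"
    proof (rule poly_mapping_eqI)
      fix i
      show "Poly_Mapping.lookup u i = Poly_Mapping.lookup (?s j) i"
        using 0 1 by (cases "i = j") (auto simp: lookup_single when_def in_keys_iff)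
    qed
    then show "u \<in> ?s ` {..<m}" using j sub by auto
  qed
  then have "P = (\<Sum>u\<in>?s ` {..<m}. Poly_Mapping.single u (Poly_Mapping.lookup P u))"
    by (intro poly_mapping_sum_single) auto
  also have "\<dots> = (\<Sum>j<m. Poly_Mapping.single (?s j) (Poly_Mapping.lookup P (?s j)))"
  proof (subst sum.reindex)
    show "inj_on ?s {..<m}" by (rule inj_onI) (metis keys_single singleton_inject zero_neq_one)
  qed simp
  also have "\<dots> = (\<Sum>j<m. Poly_Mapping.single 0 (Poly_Mapping.lookup P (?s j)) * var j)"
    by (simp add: var_def mult_single)
  finally show ?thesis .
qed

lemma eval_poly_single_0_mult:
  assumes "ring_map \<phi>"
  shows "eval_poly \<phi> v (Poly_Mapping.single 0 c * P) = \<phi> c * eval_poly \<phi> v P"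
    "eval_poly \<phi> v (P * Poly_Mapping.single 0 c) = eval_poly \<phi> v P * \<phi> c"
  by (simp_all add: eval_poly_mult[OF assms] eval_poly_single[OF assms])

lemma eval_poly_var: "ring_map \<phi> \<Longrightarrow> eval_poly \<phi> v (var i) = v i"
  by (simp add: var_def eval_poly_single ring_map_simps)

text \<open>Modulo the irrelevant ideal, the linear forms in the kernel of the Rees map become zero.
  A relation among the monomials in the generators that stays nonzero therefore contradicts
  linear type.\<close>

theorem linear_type_imp_card_le:
  fixes W :: "('v::finite, 'k::field) mvpoly set"
  assumes W: "minimal_generators W" "\<forall>w\<in>W. homogeneous w" and lt: "linear_type (ideal_gen W)"
  shows "card W \<le> CARD('v)"
proof (rule ccontr)
  fix x :: 'v
  assume "\<not> card W \<le> CARD('v)"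
  then have less: "CARD('v) < card W" by simp
  have fin: "finite W" using W(1) by (simp add: minimal_generators_def)
  obtain \<Phi> :: "(('v, 'k) mvpoly \<Rightarrow>\<^sub>0 nat) set" and l e N where \<Phi>: "finite \<Phi>"
    "\<And>f. f \<in> \<Phi> \<Longrightarrow> Poly_Mapping.keys f \<subseteq> W \<and> monom_degree f = N \<and> l f \<noteq> 0"
    "\<exists>f\<in>\<Phi>. e f = 0"
    "(\<Sum>f\<in>\<Phi>. Poly_Mapping.single (Poly_Mapping.single x (e f)) (l f) * eval_monom (\<lambda>w. w) f) = 0"
    by (rule exists_monomial_relation[OF fin W(2) less, of x], rule that)
  obtain gs L where gs: "ideal_gen (set gs) = ideal_gen W" and L: "L \<subseteq> T_polys (length gs)"
    "\<forall>P\<in>L. homogeneous_of_degree 1 P" "rees_kernel gs = ideal_gen_in (T_polys (length gs)) L"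
    using lt unfolding linear_type_def by blast
  have ker: "rees_kernel gs = ideal_gen L \<inter> T_polys (length gs)" using L by (simp add: ideal_gen_in_T_polys)
  have "\<exists>a. w = (\<Sum>j<length gs. a j * gs ! j)" if "w \<in> W" for w
    using ideal_gen_list_combination[of w gs] ideal_gen_base[OF that] gs by simp
  then obtain a where a: "\<And>w. w \<in> W \<Longrightarrow> w = (\<Sum>j<length gs. a w j * gs ! j)" by metis
  have "\<exists>b. gs ! j = (\<Sum>w\<in>W. b w * w)" if "j < length gs" for j
    using ideal_gen_base[of "gs ! j" "set gs"] that gs ideal_gen_finite[OF fin] by auto
  then have "\<forall>j\<in>{..<length gs}. \<exists>b. gs ! j = (\<Sum>w\<in>W. b w * w)" by simp
  from bchoice[OF this] obtain b where b: "\<And>j. j < length gs \<Longrightarrow> gs ! j = (\<Sum>w\<in>W. b j w * w)" by auto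
  note cc = ring_map_simps[OF ring_map_const_coeff]
  \<comment> \<open>Reduction modulo the irrelevant ideal; the target has one variable for each
    polynomial, of which those of \<open>W\<close> will occur.\<close>
  define \<epsilon> :: "('v, 'k) mvpoly \<Rightarrow> (('v, 'k) mvpoly, 'k) mvpoly"
    where "\<epsilon> c = Poly_Mapping.single 0 (const_coeff c)" for c
  have \<epsilon>: "ring_map \<epsilon>"
    unfolding \<epsilon>_def by (rule ring_map_comp[OF ring_map_single_0 ring_map_const_coeff])
  \<comment> \<open>\<open>gs\<close> is an arbitrary list of generators; its variables are
    translated into those of \<open>W\<close> through the expressions \<open>b\<close>.\<close>
  define \<Psi> where "\<Psi> = eval_poly \<epsilon> (\<lambda>j. \<Sum>w\<in>W. \<epsilon> (b j w) * var w)"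
  have \<Psi>: "ring_map \<Psi>" unfolding \<Psi>_def by (rule ring_map_eval_poly[OF \<epsilon>])
  have \<Psi>_linear: "\<Psi> (\<Sum>j<length gs. Poly_Mapping.single 0 (p j) * var j)
      = (\<Sum>w\<in>W. \<epsilon> (\<Sum>j<length gs. p j * b j w) * var w)" for p
  proof -
    have "\<Psi> (\<Sum>j<length gs. Poly_Mapping.single 0 (p j) * var j)
        = (\<Sum>j<length gs. \<Sum>w\<in>W. \<epsilon> (p j) * (\<epsilon> (b j w) * var w))"
      unfolding ring_map_simps(8)[OF \<Psi>] unfolding \<Psi>_def
      by (simp add: eval_poly_single_0_mult[OF \<epsilon>] eval_poly_var[OF \<epsilon>] sum_distrib_left)
    also have "\<dots> = (\<Sum>w\<in>W. \<epsilon> (\<Sum>j<length gs. p j * b j w) * var w)"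
      by (subst sum.swap) (simp add: ring_map_simps[OF \<epsilon>] sum_distrib_right mult.assoc)
    finally show ?thesis .
  qed
  have linear_comb: "(\<Sum>j<length gs. p j * gs ! j) = (\<Sum>w\<in>W. (\<Sum>j<length gs. p j * b j w) * w)" for p
  proof -
    have "(\<Sum>j<length gs. p j * gs ! j) = (\<Sum>j<length gs. p j * (\<Sum>w\<in>W. b j w * w))"
      by (rule sum.cong) (simp_all add: b)
    also have "\<dots> = (\<Sum>w\<in>W. (\<Sum>j<length gs. p j * b j w) * w)"
      unfolding sum_distrib_left sum_distrib_right by (subst sum.swap) (simp add: mult.assoc)
    finally show ?thesis .
  qed
  \<comment> \<open>A linear form in the kernel is a relation among \<open>gs\<close>, hence among
    \<open>W\<close>, and minimality says that the resulting coefficients have constant term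
    0.\<close>
  have \<Psi>_L: "\<Psi> P = 0" if "P \<in> L" for P
  proof -
    define p where "p j = Poly_Mapping.lookup P (Poly_Mapping.single j 1)" for j
    have PT: "P \<in> T_polys (length gs)" "homogeneous_of_degree 1 P" using that L by auto
    have P: "P = (\<Sum>j<length gs. Poly_Mapping.single 0 (p j) * var j)"
      unfolding p_def by (rule T_polys_linear[OF PT])
    have "P \<in> rees_kernel gs" using that L(1) by (auto simp: ker ideal_gen_base)
    then have "0 = eval_poly (\<lambda>x. x) ((!) gs) (degree_part 1 P)"
      using coeff_rees_map[of gs P 1] by (simp add: rees_kernel_def)
    also have "degree_part 1 P = P" using PT by (simp add: degree_part_homogeneous)
    also have "eval_poly (\<lambda>x. x) ((!) gs) P = (\<Sum>j<length gs. p j * gs ! j)"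
      by (subst P) (simp add: eval_poly_sum[OF ring_map_id] eval_poly_single_0_mult[OF ring_map_id]
          eval_poly_var[OF ring_map_id])
    finally have 0: "(\<Sum>w\<in>W. (\<Sum>j<length gs. p j * b j w) * w) = (\<Sum>w\<in>W. 0 * w)"
      unfolding linear_comb by simp
    have "\<epsilon> (\<Sum>j<length gs. p j * b j w) = 0" if "w \<in> W" for w
      using minimal_generators_unique[OF W(1) 0 that] by (simp add: \<epsilon>_def cc(4))
    then show ?thesis by (subst P) (simp add: \<Psi>_linear)
  qed
  \<comment> \<open>For \<open>w\<close> in \<open>W\<close>, the Rees map sends \<open>t w\<close>
    to \<open>w\<close> times the Rees variable, and \<open>\<Psi>\<close> sends it to the variable
    of \<open>w\<close>. The latter uses minimality: \<open>a\<close> followed by \<open>b\<close>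
    is the identity at the level of constant terms.\<close>
  define t where "t w = (\<Sum>j<length gs. Poly_Mapping.single 0 (a w j) * var j)" for w
  have \<Psi>_t: "\<Psi> (t w) = var w" if w: "w \<in> W" for w
  proof -
    have "(\<Sum>v\<in>W. (\<Sum>j<length gs. a w j * b j v) * v) = w" using a[OF w] linear_comb by simp
    also have "\<dots> = (\<Sum>v\<in>W. (if v = w then 1 else 0) * v)"
      using fin w by (subst sum.remove[of W w]) (auto intro!: sum.neutral)
    finally have eq: "(\<Sum>v\<in>W. (\<Sum>j<length gs. a w j * b j v) * v) = (\<Sum>v\<in>W. (if v = w then 1 else 0) * v)" .
    have "const_coeff (\<Sum>j<length gs. a w j * b j v) = const_coeff (if v = w then 1 else 0 :: ('v, 'k) mvpoly)"
      if "v \<in> W" for v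
      using minimal_generators_unique[OF W(1) eq that] .
    then have "\<epsilon> (\<Sum>j<length gs. a w j * b j v) = (if v = w then 1 else 0)" if "v \<in> W" for v
      using that by (simp add: \<epsilon>_def cc)
    then have "\<Psi> (t w) = (\<Sum>v\<in>W. if v = w then var v else 0)"
      unfolding t_def \<Psi>_linear by (intro sum.cong) auto
    then show ?thesis using fin w by simp
  qed
  define P where "P = (\<Sum>f\<in>\<Phi>. Poly_Mapping.single 0 (Poly_Mapping.single (Poly_Mapping.single x (e f)) (l f))
      * eval_monom t f)"
  have t_T: "t w \<in> T_polys (length gs)" for w
    unfolding t_def var_def by (intro T_polys_sum T_polys_mult T_polys_single) auto
  have "P \<in> T_polys (length gs)"
    unfolding P_def eval_monom_def
    by (intro T_polys_sum T_polys_mult T_polys_prod T_polys_power t_T T_polys_single) auto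
  moreover have "rees_map gs P = 0"
  proof -
    note rm = ring_map_simps[OF ring_map_rees_map, of gs]
    have c: "rees_map gs (Poly_Mapping.single 0 c) = [:c:]" for c
      by (simp add: rees_map_eq_eval eval_poly_single[OF ring_map_pCons])
    have "rees_map gs (t w) = Polynomial.monom w 1" if "w \<in> W" for w
    proof -
      have v: "rees_map gs (var j) = Polynomial.monom (gs ! j) 1" for j
        by (simp add: rees_map_eq_eval eval_poly_var[OF ring_map_pCons])
      have "rees_map gs (t w) = (\<Sum>j<length gs. Polynomial.monom (a w j * gs ! j) 1)"
        unfolding t_def rm by (simp add: c v smult_monom)
      also have "\<dots> = Polynomial.monom (\<Sum>j<length gs. a w j * gs ! j) 1"
        by (rule poly_eqI) (simp add: coeff_sum)
      finally show ?thesis using a[OF that] by simp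
    qed
    then have "rees_map gs (eval_monom t f) = Polynomial.monom (eval_monom (\<lambda>w. w) f) N" if "f \<in> \<Phi>" for f
      using \<Phi>(2)[OF that] unfolding eval_monom_ring_map[OF ring_map_rees_map]
      by (subst eval_monom_cong[where w="\<lambda>w. Polynomial.monom w 1"]) (auto simp only: eval_monom_monom)
    then have "rees_map gs P = (\<Sum>f\<in>\<Phi>. Polynomial.monom
        (Poly_Mapping.single (Poly_Mapping.single x (e f)) (l f) * eval_monom (\<lambda>w. w) f) N)"
      unfolding P_def rm by (simp add: c smult_monom)
    also have "\<dots> = Polynomial.monom (\<Sum>f\<in>\<Phi>. Poly_Mapping.single (Poly_Mapping.single x (e f)) (l f)
        * eval_monom (\<lambda>w. w) f) N"
      by (rule poly_eqI) (simp add: coeff_sum)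
    finally show ?thesis by (simp add: \<Phi>(4))
  qed
  ultimately have "P \<in> ideal_gen L" using ker by (auto simp: rees_kernel_def)
  then have "0 = \<Psi> P" using ring_map_ideal_gen_eq_0[OF \<Psi> _ \<Psi>_L] by simp
  \<comment> \<open>Terms with \<open>e f > 0\<close> carry a positive power of \<open>x\<close> and
    vanish under \<open>\<epsilon>\<close>. The others belong to distinct monomials and cannot
    cancel.\<close>
  also have "\<dots> = (\<Sum>f\<in>\<Phi>. Poly_Mapping.single f (l f when e f = 0))"
    unfolding P_def ring_map_simps(8)[OF \<Psi>]
  proof (rule sum.cong[OF refl])
    fix f assume f: "f \<in> \<Phi>"
    have "\<Psi> (eval_monom t f) = eval_monom var f"
      unfolding eval_monom_ring_map[OF \<Psi>] using \<Phi>(2)[OF f] \<Psi>_t by (intro eval_monom_cong) auto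
    moreover have "Poly_Mapping.single x (e f) = 0 \<longleftrightarrow> e f = 0"
      by (metis monom_degree_single monom_degree_0 single_zero)
    then have "\<epsilon> (Poly_Mapping.single (Poly_Mapping.single x (e f)) (l f)) = Poly_Mapping.single 0 (l f when e f = 0)"
      by (simp add: \<epsilon>_def const_coeff_def lookup_single when_def)
    ultimately show "\<Psi> (Poly_Mapping.single 0 (Poly_Mapping.single (Poly_Mapping.single x (e f)) (l f)) * eval_monom t f)
        = Poly_Mapping.single f (l f when e f = 0)"
      by (simp add: \<Psi>_def eval_poly_single_0_mult[OF \<epsilon>] eval_monom_vars mult_single)
  qed
  finally have 0: "(\<Sum>f\<in>\<Phi>. Poly_Mapping.single f (l f when e f = 0)) = 0" by simp
  obtain f where f: "f \<in> \<Phi>" "e f = 0" using \<Phi>(3) by blast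
  have "Poly_Mapping.lookup (\<Sum>f\<in>\<Phi>. Poly_Mapping.single f (l f when e f = 0)) f = l f"
    using f \<Phi>(1) by (simp add: lookup_sum lookup_single when_def)
  then show False using 0 \<Phi>(2)[OF f(1)] by simp
qed

section \<open>Linear type of the star configuration of height two on a regular sequence\<close>

definition forms_in :: "'i set \<Rightarrow> nat \<Rightarrow> ('i, 'a::comm_ring_1) mvpoly set" where
  "forms_in X N = {P. \<forall>u\<in>Poly_Mapping.keys P. Poly_Mapping.keys u \<subseteq> X \<and> monom_degree u = N}"

lemma forms_in_add: "P \<in> forms_in X N \<Longrightarrow> Q \<in> forms_in X N \<Longrightarrow> P + Q \<in> forms_in X N"
  using keys_add[of P Q] by (force simp: forms_in_def)

lemma forms_in_0: "0 \<in> forms_in X N"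
  by (simp add: forms_in_def)

lemma forms_in_sum: "(\<And>x. x \<in> A \<Longrightarrow> f x \<in> forms_in X N) \<Longrightarrow> sum f A \<in> forms_in X N"
  by (induction A rule: infinite_finite_induct) (auto intro: forms_in_add forms_in_0)

lemma forms_in_single: "Poly_Mapping.keys u \<subseteq> X \<Longrightarrow> monom_degree u = N \<Longrightarrow> Poly_Mapping.single u c \<in> forms_in X N"
  by (simp add: forms_in_def)

lemma forms_in_mult:
  assumes "P \<in> forms_in X M" "Q \<in> forms_in X N"
  shows "P * Q \<in> forms_in X (M + N)"
proof -
  have "Poly_Mapping.keys (a + b) \<subseteq> X" "monom_degree (a + b) = M + N"
    if "a \<in> Poly_Mapping.keys P" "b \<in> Poly_Mapping.keys Q" for a b
    using assms that keys_add[of a b] by (fastforce simp: forms_in_def monom_degree_add)+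
  then show ?thesis using keys_mult[of P Q] by (fastforce simp: forms_in_def)
qed

lemma forms_in_mono: "X \<subseteq> Y \<Longrightarrow> forms_in X N \<subseteq> forms_in Y N"
  by (fastforce simp: forms_in_def)

lemma var_power: "var i ^ k = Poly_Mapping.single (Poly_Mapping.single i k) 1"
  by (induction k) (simp_all add: var_def mult_single flip: single_add)

lemma forms_in_var_power: "i \<in> X \<Longrightarrow> (var i ^ k :: ('i, 'a::comm_ring_1) mvpoly) \<in> forms_in X k"
  unfolding var_power by (rule forms_in_single) auto

lemma forms_in_split:
  fixes P :: "('i, 'a::comm_ring_1) mvpoly"
  assumes "P \<in> forms_in (insert x Y) N" "x \<notin> Y"
  obtains Q where "\<And>k. k \<le> N \<Longrightarrow> Q k \<in> forms_in Y (N - k)" "P = (\<Sum>k\<le>N. var x ^ k * Q k)"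
proof -
  define K where "K k = {u \<in> Poly_Mapping.keys P. Poly_Mapping.lookup u x = k}" for k
  define Q where "Q k = (\<Sum>u\<in>K k. Poly_Mapping.single (u - Poly_Mapping.single x k) (Poly_Mapping.lookup P u))" for k
  have split: "u = Poly_Mapping.single x k + (u - Poly_Mapping.single x k)" if "u \<in> K k" for u k
    using that by (intro poly_mapping_eqI) (auto simp: K_def lookup_add lookup_minus lookup_single when_def)
  have "Q k \<in> forms_in Y (N - k)" for k
    unfolding Q_def
  proof (intro forms_in_sum forms_in_single)
    fix u assume u: "u \<in> K k"
    then have "Poly_Mapping.keys u \<subseteq> insert x Y" "monom_degree u = N"
      using assms(1) by (auto simp: K_def forms_in_def)
    moreover have "Poly_Mapping.keys (u - Poly_Mapping.single x k) \<subseteq> Poly_Mapping.keys u - {x}"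
      using u by (auto simp: K_def in_keys_iff lookup_minus lookup_single when_def split: if_splits)
    ultimately show "Poly_Mapping.keys (u - Poly_Mapping.single x k) \<subseteq> Y" by auto
    show "monom_degree (u - Poly_Mapping.single x k) = N - k"
      using arg_cong[OF split[OF u], of monom_degree] \<open>monom_degree u = N\<close> by (simp add: monom_degree_add)
  qed
  moreover have "P = (\<Sum>k\<le>N. var x ^ k * Q k)"
  proof -
    have "(\<Sum>k\<le>N. var x ^ k * Q k) = (\<Sum>k\<le>N. \<Sum>u\<in>K k. Poly_Mapping.single u (Poly_Mapping.lookup P u))"
      unfolding Q_def var_power sum_distrib_left mult_single
      by (intro sum.cong refl) (simp flip: split)
    also have "\<dots> = (\<Sum>u\<in>(\<Union>k\<in>{..N}. K k). Poly_Mapping.single u (Poly_Mapping.lookup P u))"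
      by (subst sum.UNION_disjoint) (auto simp: K_def)
    also have "(\<Union>k\<in>{..N}. K k) = Poly_Mapping.keys P"
    proof -
      have "Poly_Mapping.lookup u x \<le> N" if "u \<in> Poly_Mapping.keys P" for u
      proof (cases "x \<in> Poly_Mapping.keys u")
        case True
        then have "Poly_Mapping.lookup u x \<le> monom_degree u"
          unfolding monom_degree_def by (intro member_le_sum) auto
        then show ?thesis using that assms(1) by (auto simp: forms_in_def)
      qed (simp add: in_keys_iff)
      then show ?thesis by (auto simp: K_def)
    qed
    finally show ?thesis using poly_mapping_sum_single[of "Poly_Mapping.keys P" P] by simp
  qed
  ultimately show ?thesis using that by blast
qed

text \<open>Substituting the cofactor of \<open>i\<close> for \<open>var i\<close> turns each
  \<open>h i * var i\<close> into the same full product, so these differences are the evident linear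
  relations.\<close>

definition syzygies :: "('i \<Rightarrow> 'a::comm_ring_1) \<Rightarrow> 'i set \<Rightarrow> ('i, 'a) mvpoly set" where
  "syzygies h X = {Poly_Mapping.single 0 (h i) * var i - Poly_Mapping.single 0 (h j) * var j |i j. i \<in> X \<and> j \<in> X}"

definition eval_cofactors :: "('i \<Rightarrow> 'a::comm_ring_1) \<Rightarrow> 'i set \<Rightarrow> ('i, 'a) mvpoly \<Rightarrow> 'a" where
  "eval_cofactors h X = eval_poly (\<lambda>c. c) (\<lambda>i. \<Prod>j\<in>X - {i}. h j)"

lemma ring_map_eval_cofactors: "ring_map (eval_cofactors h X)"
  by (simp add: eval_cofactors_def ring_map_eval_poly ring_map_id)

lemma eval_cofactors_var: "eval_cofactors h X (var i) = (\<Prod>j\<in>X - {i}. h j)"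
  by (simp add: eval_cofactors_def eval_poly_var ring_map_id)

lemma eval_cofactors_single_0: "eval_cofactors h X (Poly_Mapping.single 0 c) = c"
  by (simp add: eval_cofactors_def eval_poly_single ring_map_id)

lemma eval_cofactors_syzygies:
  assumes "finite X" "P \<in> ideal_gen (syzygies h X)"
  shows "eval_cofactors h X P = 0"
proof (rule ring_map_ideal_gen_eq_0[OF ring_map_eval_cofactors assms(2)])
  fix s assume "s \<in> syzygies h X"
  then obtain i j where "i \<in> X" "j \<in> X"
    "s = Poly_Mapping.single 0 (h i) * var i - Poly_Mapping.single 0 (h j) * var j"
    by (auto simp: syzygies_def)
  then show "eval_cofactors h X s = 0" using assms(1)
    by (simp add: ring_map_simps[OF ring_map_eval_cofactors] eval_cofactors_var eval_cofactors_single_0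
        flip: prod.remove)
qed

text \<open>Each cofactor of an element of \<open>Y\<close> gains one factor \<open>h x\<close>, and
  a form of degree \<open>M\<close> contains \<open>M\<close> of them per term.\<close>

lemma eval_cofactors_insert:
  assumes "finite Y" "x \<notin> Y" "P \<in> forms_in Y M"
  shows "eval_cofactors h (insert x Y) P = h x ^ M * eval_cofactors h Y P"
proof -
  have "eval_monom (\<lambda>i. \<Prod>j\<in>insert x Y - {i}. h j) u = h x ^ M * eval_monom (\<lambda>i. \<Prod>j\<in>Y - {i}. h j) u"
    if "u \<in> Poly_Mapping.keys P" for u
  proof -
    have u: "Poly_Mapping.keys u \<subseteq> Y" "monom_degree u = M" using that assms(3) by (auto simp: forms_in_def)
    have "(\<Prod>j\<in>insert x Y - {i}. h j) = h x * (\<Prod>j\<in>Y - {i}. h j)" if "i \<in> Y" for i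
    proof -
      have "insert x Y - {i} = insert x (Y - {i})" using that assms(2) by auto
      then show ?thesis using assms by simp
    qed
    then have "eval_monom (\<lambda>i. \<Prod>j\<in>insert x Y - {i}. h j) u = eval_monom (\<lambda>i. h x * (\<Prod>j\<in>Y - {i}. h j)) u"
      using u by (intro eval_monom_cong) auto
    also have "\<dots> = h x ^ M * eval_monom (\<lambda>i. \<Prod>j\<in>Y - {i}. h j) u"
      by (simp add: eval_monom_def power_mult_distrib prod.distrib monom_degree_def power_sum flip: u(2))
    finally show ?thesis .
  qed
  then show ?thesis
    by (simp add: eval_cofactors_def eval_poly_def sum_distrib_left mult_ac cong: sum.cong)
qed

lemma eval_cofactors_coeffs:
  assumes "\<And>u. Poly_Mapping.lookup q u \<in> ideal_gen B"
  shows "eval_cofactors h X q \<in> ideal_gen B"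
  unfolding eval_cofactors_def eval_poly_def
  by (intro ideal_gen_sum ideal_gen_mult2 assms)

text \<open>The splitting is done coefficientwise on the support of \<open>q\<close>, so both parts
  stay forms of the same degree.\<close>

lemma coeffs_in_ideal_insert:
  fixes q :: "('i, 'a::comm_ring_1) mvpoly"
  assumes "q \<in> forms_in X N" "\<And>u. Poly_Mapping.lookup q u \<in> ideal_gen (insert b B)"
  obtains q' s where "q' \<in> forms_in X N" "s \<in> forms_in X N" "\<And>u. Poly_Mapping.lookup q' u \<in> ideal_gen B"
    "q = q' + Poly_Mapping.single 0 b * s"
proof -
  have "\<forall>u. \<exists>i s. i \<in> ideal_gen B \<and> Poly_Mapping.lookup q u = i + s * b"
    using assms(2) by (metis ideal_gen_insertE)
  then obtain i s where is': "\<And>u. i u \<in> ideal_gen B" "\<And>u. Poly_Mapping.lookup q u = i u + s u * b"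
    by metis
  let ?K = "Poly_Mapping.keys q"
  define q' where "q' = (\<Sum>u\<in>?K. Poly_Mapping.single u (i u))"
  define s' where "s' = (\<Sum>u\<in>?K. Poly_Mapping.single u (s u))"
  have "Poly_Mapping.keys u \<subseteq> X" "monom_degree u = N" if "u \<in> ?K" for u
    using assms(1) that by (simp_all add: forms_in_def)
  then have "q' \<in> forms_in X N" "s' \<in> forms_in X N"
    unfolding q'_def s'_def by (intro forms_in_sum forms_in_single; simp)+
  moreover have "Poly_Mapping.lookup q' u \<in> ideal_gen B" for u
    using is'(1) by (auto simp: q'_def lookup_sum lookup_single when_def intro!: ideal_gen_sum ideal_gen_zero)
  moreover have "q = q' + Poly_Mapping.single 0 b * s'"
    using poly_mapping_sum_single[of ?K q] is'(2)
    by (simp add: q'_def s'_def sum_distrib_left mult_single single_add sum.distrib mult.commute)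
  ultimately show ?thesis using that by blast
qed

lemma syzygies_mono: "X \<subseteq> Y \<Longrightarrow> syzygies h X \<subseteq> syzygies h Y"
  by (auto simp: syzygies_def)

text \<open>The inner induction, on the degree \<open>D\<close> in the variable of \<open>x\<close>.
  After a power of \<open>h x\<close> is cancelled, every term below the top one is a multiple of
  \<open>h x\<close>. The product of the other \<open>h j\<close> is regular modulo
  \<open>h x\<close>, so the top coefficient satisfies the hypothesis of \<open>IH\<close> with
  \<open>h x\<close> added to the base; hence \<open>IH\<close> is quantified over
  \<open>B\<close>.\<close>

lemma reduce_mod_syzygies:
  fixes h :: "'i \<Rightarrow> 'a::comm_ring_1"
  assumes Y: "finite Y" "x \<notin> Y" "y \<in> Y"
    and nzd: "\<And>i T. i \<in> insert x Y \<Longrightarrow> T \<subseteq> insert x Y - {i} \<Longrightarrow> nonzerodivisor_mod (h i) (B \<union> h ` T)"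
    and IH: "\<And>B M P. (\<And>i T. i \<in> Y \<Longrightarrow> T \<subseteq> Y - {i} \<Longrightarrow> nonzerodivisor_mod (h i) (B \<union> h ` T)) \<Longrightarrow>
      P \<in> forms_in Y M \<Longrightarrow> eval_cofactors h Y P \<in> ideal_gen B \<Longrightarrow>
      \<exists>q\<in>forms_in Y M. (\<forall>u. Poly_Mapping.lookup q u \<in> ideal_gen B) \<and> P - q \<in> ideal_gen (syzygies h Y)"
    and "D \<le> N" "\<And>k. k \<le> D \<Longrightarrow> Q k \<in> forms_in Y (N - k)"
    and "eval_cofactors h (insert x Y) (\<Sum>k\<le>D. var x ^ k * Q k) \<in> ideal_gen B"
  shows "\<exists>q\<in>forms_in (insert x Y) N. (\<forall>u. Poly_Mapping.lookup q u \<in> ideal_gen B) \<and>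
    (\<Sum>k\<le>D. var x ^ k * Q k) - q \<in> ideal_gen (syzygies h (insert x Y))"
  using assms(6-8)
proof (induction D arbitrary: Q)
  have x: "nonzerodivisor_mod (h x) B" using nzd[of x "{}"] by simp
  have sub: "ideal_gen (syzygies h Y) \<subseteq> ideal_gen (syzygies h (insert x Y))"
    by (intro ideal_gen_mono syzygies_mono) auto
  note ev = ring_map_simps[OF ring_map_eval_cofactors, of h "insert x Y"]
  {
    case 0
    have Q: "Q 0 \<in> forms_in Y N" using 0(2)[of 0] by simp
    have "h x ^ N * eval_cofactors h Y (Q 0) \<in> ideal_gen B"
      using 0(3) eval_cofactors_insert[OF Y(1,2) Q] by simp
    then have "eval_cofactors h Y (Q 0) \<in> ideal_gen B"
      using nonzerodivisor_mod_power[OF x] by (simp add: mult.commute)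
    moreover have "nonzerodivisor_mod (h i) (B \<union> h ` T)" if "i \<in> Y" "T \<subseteq> Y - {i}" for i T
      using that by (intro nzd) auto
    ultimately obtain q where "q \<in> forms_in Y N" "\<forall>u. Poly_Mapping.lookup q u \<in> ideal_gen B"
      "Q 0 - q \<in> ideal_gen (syzygies h Y)"
      using IH[OF _ Q] by blast
    then show ?case using sub forms_in_mono[of Y "insert x Y" N] by (intro bexI[of _ q]) auto
  next
    case (Suc D)
    let ?e = "eval_cofactors h Y"
    define g where "g = (\<Prod>j\<in>Y. h j)"
    have "insert x Y - {x} = Y" using Y by auto
    then have ev_x: "eval_cofactors h (insert x Y) (var x) = g" by (simp add: eval_cofactors_var g_def)
    have Q: "Q k \<in> forms_in Y (N - k)" if "k \<le> Suc D" for k using Suc.prems(2) that by simp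
    have ev_Q: "eval_cofactors h (insert x Y) (Q k) = h x ^ (N - k) * ?e (Q k)" if "k \<le> Suc D" for k
      by (rule eval_cofactors_insert[OF Y(1,2) Q[OF that]])
    have "eval_cofactors h (insert x Y) (\<Sum>k\<le>Suc D. var x ^ k * Q k)
        = (\<Sum>k\<le>Suc D. g ^ k * (h x ^ (N - k) * ?e (Q k)))"
      unfolding ev ev_x by (intro sum.cong refl) (simp add: ev_Q)
    also have "\<dots> = (\<Sum>k\<le>Suc D. (g ^ k * h x ^ (Suc D - k) * ?e (Q k)) * h x ^ (N - Suc D))"
    proof (rule sum.cong[OF refl])
      fix k assume "k \<in> {..Suc D}"
      then have "N - k = (Suc D - k) + (N - Suc D)" using Suc.prems(1) by auto
      then show "g ^ k * (h x ^ (N - k) * ?e (Q k)) = (g ^ k * h x ^ (Suc D - k) * ?e (Q k)) * h x ^ (N - Suc D)"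
        by (simp only: power_add mult_ac)
    qed
    finally have "(\<Sum>k\<le>Suc D. g ^ k * h x ^ (Suc D - k) * ?e (Q k)) * h x ^ (N - Suc D) \<in> ideal_gen B"
      using Suc.prems(3) by (simp only: sum_distrib_right)
    then have "(\<Sum>k\<le>Suc D. g ^ k * h x ^ (Suc D - k) * ?e (Q k)) \<in> ideal_gen B"
      by (rule nonzerodivisor_mod_power[OF x])
    then have "(\<Sum>k\<le>D. g ^ k * h x ^ (Suc D - k) * ?e (Q k)) + g ^ Suc D * ?e (Q (Suc D)) \<in> ideal_gen B"
      by simp
    then have *: "(\<Sum>k\<le>D. g ^ k * h x ^ (Suc D - k) * ?e (Q k)) + g ^ Suc D * ?e (Q (Suc D)) \<in> ideal_gen (insert (h x) B)"
      using ideal_gen_mono[of B "insert (h x) B"] by blast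
    have "(\<Sum>k\<le>D. g ^ k * h x ^ (Suc D - k) * ?e (Q k)) \<in> ideal_gen (insert (h x) B)"
    proof (rule ideal_gen_sum)
      fix k assume "k \<in> {..D}"
      then have "g ^ k * h x ^ (Suc D - k) * ?e (Q k) = (g ^ k * h x ^ (D - k) * ?e (Q k)) * h x"
        by (simp add: Suc_diff_le mult_ac)
      then show "g ^ k * h x ^ (Suc D - k) * ?e (Q k) \<in> ideal_gen (insert (h x) B)"
        by (simp only: ideal_gen_mult ideal_gen_base insertI1)
    qed
    from ideal_gen_diff[OF * this] have "?e (Q (Suc D)) * g ^ Suc D \<in> ideal_gen (insert (h x) B)"
      by (simp add: mult_ac)
    moreover have nzd': "nonzerodivisor_mod (h i) (insert (h x) B \<union> h ` T)" if "i \<in> Y" "T \<subseteq> Y - {i}" for i T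
      using nzd[of i "insert x T"] that Y by auto
    then have "nonzerodivisor_mod (h i) (insert (h x) B)" if "i \<in> Y" for i
      using that nzd'[of i "{}"] by simp
    then have "nonzerodivisor_mod g (insert (h x) B)"
      unfolding g_def using nonzerodivisor_mod_prod[of Y h] by (auto simp: nonzerodivisor_mod_def[of "prod h Y"])
    ultimately have "?e (Q (Suc D)) \<in> ideal_gen (insert (h x) B)"
      using nonzerodivisor_mod_power by blast
    from IH[OF nzd' Q[OF order_refl] this]
    obtain q where q: "q \<in> forms_in Y (N - Suc D)" "\<And>u. Poly_Mapping.lookup q u \<in> ideal_gen (insert (h x) B)"
      "Q (Suc D) - q \<in> ideal_gen (syzygies h Y)" by blast
    obtain q' s where q': "q' \<in> forms_in Y (N - Suc D)" "s \<in> forms_in Y (N - Suc D)"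
      "\<And>u. Poly_Mapping.lookup q' u \<in> ideal_gen B" "q = q' + Poly_Mapping.single 0 (h x) * s"
      using coeffs_in_ideal_insert[OF q(1,2)] by blast
    \<comment> \<open>The syzygy of \<open>x\<close> and \<open>y\<close> replaces
      \<open>h x * var x * s\<close> by \<open>r\<close>. One power of \<open>var x\<close> is lost,
      so \<open>r\<close> joins the coefficient of \<open>var x ^ D\<close>.\<close>
    define r where "r = Poly_Mapping.single 0 (h y) * var y * s"
    define Q' where "Q' k = (if k = D then Q k + r else Q k)" for k
    have "Poly_Mapping.single 0 (h y) * var y \<in> forms_in Y 1"
      using Y(3) by (simp add: var_def mult_single forms_in_single)
    from forms_in_mult[OF this q'(2)] have "r \<in> forms_in Y (N - D)"
      using Suc.prems(1) by (simp add: r_def Suc_diff_Suc)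
    then have Q'_forms: "Q' k \<in> forms_in Y (N - k)" if "k \<le> D" for k
      using Q[of k] that by (auto simp: Q'_def intro: forms_in_add)
    have "(\<Sum>k\<le>D. var x ^ k * Q' k) = (\<Sum>k\<le>D. var x ^ k * Q k + (if k = D then var x ^ D * r else 0))"
      by (intro sum.cong refl) (simp add: Q'_def distrib_left)
    then have Q'_sum: "(\<Sum>k\<le>D. var x ^ k * Q' k) = (\<Sum>k\<le>D. var x ^ k * Q k) + var x ^ D * r"
      by (simp add: sum.distrib)
    have red: "(\<Sum>k\<le>Suc D. var x ^ k * Q k) - (\<Sum>k\<le>D. var x ^ k * Q' k) - var x ^ Suc D * q'
        \<in> ideal_gen (syzygies h (insert x Y))"
    proof -
      have "(\<Sum>k\<le>Suc D. var x ^ k * Q k) - (\<Sum>k\<le>D. var x ^ k * Q' k) - var x ^ Suc D * q'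
          = var x ^ Suc D * (Q (Suc D) - q)
          + var x ^ D * s * (Poly_Mapping.single 0 (h x) * var x - Poly_Mapping.single 0 (h y) * var y)"
        unfolding Q'_sum by (simp add: q'(4) r_def algebra_simps)
      moreover have "Poly_Mapping.single 0 (h x) * var x - Poly_Mapping.single 0 (h y) * var y
          \<in> ideal_gen (syzygies h (insert x Y))"
        using Y(3) by (intro ideal_gen_base) (auto simp: syzygies_def)
      moreover have "Q (Suc D) - q \<in> ideal_gen (syzygies h (insert x Y))" using q(3) sub by blast
      ultimately show ?thesis by (simp only: ideal_gen_add ideal_gen_mult)
    qed
    \<comment> \<open>The split-off part \<open>q'\<close> has coefficients in the ideal of
      \<open>B\<close>, so the shorter sum still satisfies the hypothesis of the induction on
      \<open>D\<close>.\<close>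
    have "eval_cofactors h (insert x Y) (\<Sum>k\<le>D. var x ^ k * Q' k) =
        eval_cofactors h (insert x Y) (\<Sum>k\<le>Suc D. var x ^ k * Q k)
        - eval_cofactors h (insert x Y) (var x ^ Suc D) * eval_cofactors h (insert x Y) q'"
      using eval_cofactors_syzygies[OF _ red] Y(1) by (simp add: ev algebra_simps)
    also have "\<dots> \<in> ideal_gen B"
      by (intro ideal_gen_diff[OF Suc.prems(3)] ideal_gen_mult eval_cofactors_coeffs q'(3))
    finally obtain p where p: "p \<in> forms_in (insert x Y) N" "\<And>u. Poly_Mapping.lookup p u \<in> ideal_gen B"
      "(\<Sum>k\<le>D. var x ^ k * Q' k) - p \<in> ideal_gen (syzygies h (insert x Y))"
      using Suc.IH[of Q'] Suc.prems(1) Q'_forms by (meson Suc_leD)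
    show ?case
    proof (intro bexI[of _ "p + var x ^ Suc D * q'"] conjI allI)
      have "q' \<in> forms_in (insert x Y) (N - Suc D)" using q'(1) forms_in_mono[of Y "insert x Y"] by blast
      then have "var x ^ Suc D * q' \<in> forms_in (insert x Y) (Suc D + (N - Suc D))"
        by (intro forms_in_mult forms_in_var_power) auto
      then show "p + var x ^ Suc D * q' \<in> forms_in (insert x Y) N"
        using p(1) Suc.prems(1) by (intro forms_in_add) auto
      have "(\<Sum>k\<le>Suc D. var x ^ k * Q k) - (p + var x ^ Suc D * q') =
          ((\<Sum>k\<le>Suc D. var x ^ k * Q k) - (\<Sum>k\<le>D. var x ^ k * Q' k) - var x ^ Suc D * q')
          + ((\<Sum>k\<le>D. var x ^ k * Q' k) - p)" by (simp add: algebra_simps)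
      also have "\<dots> \<in> ideal_gen (syzygies h (insert x Y))" by (rule ideal_gen_add[OF red p(3)])
      finally show "(\<Sum>k\<le>Suc D. var x ^ k * Q k) - (p + var x ^ Suc D * q')
          \<in> ideal_gen (syzygies h (insert x Y))" .
      fix u
      have "Poly_Mapping.lookup (var x ^ Suc D * q') u \<in> ideal_gen B"
      proof -
        have "var x ^ Suc D * q' = var x ^ Suc D *
            (\<Sum>w\<in>Poly_Mapping.keys q'. Poly_Mapping.single w (Poly_Mapping.lookup q' w))"
          by (rule arg_cong[OF poly_mapping_sum_single]) auto
        also have "\<dots> = (\<Sum>w\<in>Poly_Mapping.keys q'.
            Poly_Mapping.single (Poly_Mapping.single x (Suc D) + w) (Poly_Mapping.lookup q' w))"
          unfolding var_power sum_distrib_left mult_single by simp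
        finally have "var x ^ Suc D * q' = \<dots>" .
        then show ?thesis
          using q'(3) by (auto simp: lookup_sum lookup_single when_def intro!: ideal_gen_sum ideal_gen_zero)
      qed
      then show "Poly_Mapping.lookup (p + var x ^ Suc D * q') u \<in> ideal_gen B"
        using p(2) by (simp add: lookup_add ideal_gen_add)
    qed
  }
qed

text \<open>A form that vanishes modulo \<open>B\<close> on the cofactors of a regular family is, modulo the linear
  syzygies, a form with coefficients in the ideal of \<open>B\<close>. The induction moves one element \<open>x\<close> of the
  family into \<open>B\<close>: the coefficient of the top power of its variable vanishes modulo \<open>B\<close> and
  \<open>h x\<close>, and a multiple of \<open>h x\<close> there can be traded for a lower power.\<close>

lemma kernel_mod_syzygies:
  fixes h :: "'i \<Rightarrow> 'a::comm_ring_1"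
  assumes "finite X" "X \<noteq> {}"
    and "\<And>i T. i \<in> X \<Longrightarrow> T \<subseteq> X - {i} \<Longrightarrow> nonzerodivisor_mod (h i) (B \<union> h ` T)"
    and "P \<in> forms_in X N" "eval_cofactors h X P \<in> ideal_gen B"
  shows "\<exists>q\<in>forms_in X N. (\<forall>u. Poly_Mapping.lookup q u \<in> ideal_gen B) \<and> P - q \<in> ideal_gen (syzygies h X)"
  using assms
proof (induction X arbitrary: B P N rule: finite_ne_induct)
  case (singleton x)
  \<comment> \<open>The cofactor of a single element is the empty product 1. Evaluation thus returns
    the only coefficient of \<open>P\<close>, and \<open>q = P\<close> works.\<close>
  have "u = Poly_Mapping.single x N" if "u \<in> Poly_Mapping.keys P" for u
  proof -
    have "Poly_Mapping.keys u \<subseteq> {x}" "monom_degree u = N" using that singleton.prems(2) by (auto simp: forms_in_def)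
    then show ?thesis using poly_mapping_sum_single[of "{x}" u] monom_degree_superset[of "{x}" u] by simp
  qed
  then have keys: "Poly_Mapping.keys P \<subseteq> {Poly_Mapping.single x N}" by auto
  then have P: "P = Poly_Mapping.single (Poly_Mapping.single x N) (Poly_Mapping.lookup P (Poly_Mapping.single x N))"
    using poly_mapping_sum_single[OF _ keys] by simp
  have "eval_cofactors h {x} P = Poly_Mapping.lookup P (Poly_Mapping.single x N)"
    by (subst P) (simp add: eval_cofactors_def eval_poly_single ring_map_id)
  then have "Poly_Mapping.lookup P (Poly_Mapping.single x N) \<in> ideal_gen B" using singleton.prems(3) by simp
  then have "Poly_Mapping.lookup P u \<in> ideal_gen B" for u
    using keys ideal_gen_zero[of B] by (cases "u \<in> Poly_Mapping.keys P") (auto simp: in_keys_iff)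
  then show ?case using singleton.prems(2) by (intro bexI[of _ P]) (auto simp: ideal_gen_zero)
next
  case (insert x Y)
  obtain y where y: "y \<in> Y" using insert.hyps by auto
  obtain Q where Q: "\<And>k. k \<le> N \<Longrightarrow> Q k \<in> forms_in Y (N - k)" "P = (\<Sum>k\<le>N. var x ^ k * Q k)"
    using forms_in_split[OF insert.prems(2)] insert.hyps by metis
  show ?case unfolding Q(2)
    by (rule reduce_mod_syzygies[OF insert.hyps(1) insert.hyps(3) y insert.prems(1) insert.IH order_refl Q(1)])
      (use insert.prems(3) Q(2) in auto)
qed

lemma star_gens_2_eq:
  assumes "2 \<le> card F"
  shows "star_gens 2 F = (\<lambda>f. \<Prod>(F - {f})) ` F"
proof -
  have fin: "finite F" using assms by (intro card_ge_0_finite) simp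
  have "A \<subseteq> F \<and> card A = card F - 2 + 1 \<longleftrightarrow> (\<exists>f\<in>F. A = F - {f})" for A
  proof
    assume A: "A \<subseteq> F \<and> card A = card F - 2 + 1"
    then have "finite A" using fin finite_subset by blast
    with A have "card (F - A) = 1" using assms by (simp add: card_Diff_subset)
    then obtain f where "F - A = {f}" by (auto simp: card_1_singleton_iff)
    then show "\<exists>f\<in>F. A = F - {f}" using A by (intro bexI[of _ f]) auto
  next
    assume "\<exists>f\<in>F. A = F - {f}"
    then show "A \<subseteq> F \<and> card A = card F - 2 + 1" using fin assms by auto
  qed
  then have "star_gens 2 F = {\<Prod>A |A. \<exists>f\<in>F. A = F - {f}}" by (simp only: star_gens_def)
  also have "\<dots> = (\<lambda>f. \<Prod>(F - {f})) ` F" by auto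
  finally show ?thesis .
qed

text \<open>\<open>kernel_mod_syzygies\<close> is applied with empty base to each homogeneous part;
  coefficients in the zero ideal force the correction \<open>q\<close> to vanish.\<close>

lemma rees_kernel_cofactors:
  fixes h :: "nat \<Rightarrow> 'a::comm_ring_1"
  assumes "0 < t" and nzd: "\<And>i T. i < t \<Longrightarrow> T \<subseteq> {..<t} - {i} \<Longrightarrow> nonzerodivisor_mod (h i) (h ` T)"
    and gs: "gs = map (\<lambda>i. \<Prod>j\<in>{..<t} - {i}. h j) [0..<t]"
  shows "rees_kernel gs = ideal_gen (syzygies h {..<t}) \<inter> T_polys t"
proof -
  have len: "length gs = t" by (simp add: gs)
  have coeff: "poly.coeff (rees_map gs P) d = eval_cofactors h {..<t} (degree_part d P)"
    if "P \<in> T_polys t" for P d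
  proof -
    have "eval_monom ((!) gs) u = eval_monom (\<lambda>i. \<Prod>j\<in>{..<t} - {i}. h j) u"
      if "u \<in> Poly_Mapping.keys (degree_part d P)" for u
    proof (rule eval_monom_cong)
      fix i assume "i \<in> Poly_Mapping.keys u"
      then have "i < t" using that \<open>P \<in> T_polys t\<close> by (auto simp: T_polys_def keys_degree_part)
      then show "gs ! i = (\<Prod>j\<in>{..<t} - {i}. h j)" by (simp add: gs)
    qed
    then show ?thesis unfolding coeff_rees_map eval_cofactors_def eval_poly_def by (simp cong: sum.cong)
  qed
  have "P \<in> ideal_gen (syzygies h {..<t})" if P: "P \<in> T_polys t" "rees_map gs P = 0" for P
  proof -
    have "degree_part d P \<in> ideal_gen (syzygies h {..<t})" for d
    proof -
      have "degree_part d P \<in> forms_in {..<t} d"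
        using P(1) by (auto simp: forms_in_def T_polys_def keys_degree_part)
      moreover have "eval_cofactors h {..<t} (degree_part d P) \<in> ideal_gen {}"
        using coeff[OF P(1), of d] P(2) by (simp add: ideal_gen_zero)
      ultimately obtain q where q: "\<forall>u. Poly_Mapping.lookup q u \<in> ideal_gen {}"
        "degree_part d P - q \<in> ideal_gen (syzygies h {..<t})"
        using kernel_mod_syzygies[of "{..<t}" h "{}" "degree_part d P" d] assms(1) nzd by auto
      have "ideal_gen ({} :: 'a set) = {0}"
        unfolding ideal_gen_def by (rule module.span_empty[OF module_mult])
      then have "q = 0" using q(1) by (intro poly_mapping_eqI) auto
      then show ?thesis using q(2) by simp
    qed
    then have "(\<Sum>d\<in>monom_degree ` Poly_Mapping.keys P. degree_part d P) \<in> ideal_gen (syzygies h {..<t})"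
      by (intro ideal_gen_sum)
    then show ?thesis by (simp add: sum_degree_parts)
  qed
  moreover have "rees_map gs P = 0" if "P \<in> ideal_gen (syzygies h {..<t})" for P
  proof (rule ring_map_ideal_gen_eq_0[OF ring_map_rees_map that])
    fix s assume "s \<in> syzygies h {..<t}"
    then obtain i j where ij: "i < t" "j < t"
      "s = Poly_Mapping.single 0 (h i) * var i - Poly_Mapping.single 0 (h j) * var j"
      by (auto simp: syzygies_def)
    have "rees_map gs (Poly_Mapping.single 0 (h k) * var k) = Polynomial.monom (\<Prod>j<t. h j) 1" if "k < t" for k
    proof -
      have "rees_map gs (Poly_Mapping.single 0 (h k) * var k) = smult (h k) (Polynomial.monom (gs ! k) 1)"
        by (simp add: rees_map_eq_eval eval_poly_single_0_mult ring_map_pCons eval_poly_var)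
      also have "\<dots> = Polynomial.monom (h k * (\<Prod>j\<in>{..<t} - {k}. h j)) 1"
        using that by (simp add: gs smult_monom)
      also have "h k * (\<Prod>j\<in>{..<t} - {k}. h j) = (\<Prod>j<t. h j)"
        using that by (simp add: prod.remove)
      finally show ?thesis .
    qed
    then show "rees_map gs s = 0" using ij by (simp add: ring_map_simps[OF ring_map_rees_map])
  qed
  ultimately show ?thesis by (auto simp: rees_kernel_def len)
qed

lemma star_like_2:
  assumes "finite F" "2 \<le> card F" "\<And>f. f \<in> F \<Longrightarrow> pos_homogeneous f"
    and "\<And>f T. T \<subseteq> F \<Longrightarrow> f \<in> F - T \<Longrightarrow> nonzerodivisor_mod f T"
  shows "star_like 2 F"
  using assms by (simp add: star_like_def)

text \<open>A listing of \<open>F\<close> turns the cofactors into a list of generators. Its length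
  is minimal, as \<open>linear_type\<close> demands, because
  \<open>card F choose 1 = card F\<close>.\<close>

lemma linear_type_star_ideal_2:
  fixes F :: "('v, 'k::field) mvpoly set"
  assumes F: "finite F" "2 \<le> card F" "\<And>f. f \<in> F \<Longrightarrow> pos_homogeneous f"
    and nzd: "\<And>f T. T \<subseteq> F \<Longrightarrow> f \<in> F - T \<Longrightarrow> nonzerodivisor_mod f T"
  shows "linear_type (star_ideal 2 F)"
proof -
  have star: "star_like 2 F" using assms by (rule star_like_2)
  obtain fs where fs: "set fs = F" "distinct fs" using finite_distinct_list[OF F(1)] by blast
  define t where "t = length fs"
  have t: "t = card F" using fs by (simp add: t_def distinct_card[symmetric])
  define h where "h = (!) fs"
  have inj: "inj_on h {..<t}" using fs(2) by (simp add: h_def t_def inj_on_nth)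
  have img: "h ` {..<t} = F" using fs(1) by (auto simp: h_def t_def in_set_conv_nth)
  define gs where "gs = map (\<lambda>i. \<Prod>j\<in>{..<t} - {i}. h j) [0..<t]"
  have "(\<Prod>j\<in>{..<t} - {i}. h j) = \<Prod>(F - {h i})" if "i < t" for i
  proof -
    have "F - {h i} = h ` ({..<t} - {i})" using img inj that by (auto simp: inj_on_def)
    moreover have "inj_on h ({..<t} - {i})" using inj by (rule inj_on_subset) auto
    ultimately show ?thesis by (simp add: prod.reindex)
  qed
  then have "set gs = (\<lambda>i. \<Prod>(F - {h i})) ` {..<t}" by (auto simp: gs_def)
  also have "\<dots> = (\<lambda>f. \<Prod>(F - {f})) ` h ` {..<t}" by (simp only: image_image)
  also have "\<dots> = star_gens 2 F" by (simp only: img star_gens_2_eq[OF F(2)])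
  finally have "set gs = star_gens 2 F" .
  then have 1: "ideal_gen (set gs) = star_ideal 2 F" by (simp add: star_ideal_eq_prods[OF star])
  have len: "length gs = t" by (simp add: gs_def)
  have 2: "length gs = min_gens (star_ideal 2 F)"
    using len t by (simp add: min_gens_star_ideal[OF star])
  have nzd_h: "nonzerodivisor_mod (h i) (h ` T)" if "i < t" "T \<subseteq> {..<t} - {i}" for i T
  proof (rule nzd)
    show "h ` T \<subseteq> F" "h i \<in> F - h ` T" using that img inj by (auto simp: inj_on_def)
  qed
  have "0 < t" using t F(2) by simp
  from rees_kernel_cofactors[OF this nzd_h gs_def]
  have ker: "rees_kernel gs = ideal_gen (syzygies h {..<t}) \<inter> T_polys t" .
  have syz: "syzygies h {..<t} \<subseteq> T_polys t \<inter> {P. homogeneous_of_degree 1 P}"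
  proof
    fix P assume "P \<in> syzygies h {..<t}"
    then obtain i j where ij: "i < t" "j < t"
      "P = Poly_Mapping.single (Poly_Mapping.single i 1) (h i) + Poly_Mapping.single (Poly_Mapping.single j 1) (- h j)"
      by (auto simp: syzygies_def var_def mult_single single_uminus)
    then show "P \<in> T_polys t \<inter> {P. homogeneous_of_degree 1 P}"
      by (auto intro!: T_polys_add T_polys_single homogeneous_of_degree_add)
  qed
  then have "rees_kernel gs = ideal_gen_in (T_polys (length gs)) (syzygies h {..<t})"
    unfolding len ker by (subst ideal_gen_in_T_polys) auto
  then show ?thesis unfolding linear_type_def
    using 1 2 syz len by (intro exI[of _ gs] conjI exI[of _ "syzygies h {..<t}"]) auto
qed

lemma homogeneous_prod:
  fixes A :: "('v, 'k::comm_ring_1) mvpoly set"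
  assumes "\<And>f. f \<in> A \<Longrightarrow> homogeneous f"
  shows "homogeneous (\<Prod>A)"
proof -
  obtain d where "\<And>f. f \<in> A \<Longrightarrow> homogeneous_of_degree (d f) f"
    using assms unfolding homogeneous_def by metis
  then show ?thesis using homogeneous_of_degree_prod[of A d "\<lambda>f. f"] by (auto simp: homogeneous_def)
qed

lemma linear_type_star_ideal_imp_le:
  fixes F :: "('v::finite, 'k::field) mvpoly set"
  assumes star: "star_like c F" and lt: "linear_type (star_ideal c F)"
  shows "card F choose (c - 1) \<le> CARD('v)"
proof -
  have "homogeneous (\<Prod>A)" if "A \<subseteq> F" for A
    by (rule homogeneous_prod) (use star that pos_homogeneousD in \<open>auto simp: star_like_def\<close>)
  then have "\<forall>w\<in>star_gens c F. homogeneous w" by (auto simp: star_gens_def)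
  then have "card (star_gens c F) \<le> CARD('v)"
    using linear_type_imp_card_le[OF minimal_generators_star_gens[OF star]] lt
    by (simp add: star_ideal_eq_prods[OF star])
  then show ?thesis by (simp add: card_star_gens[OF star])
qed

text \<open>This stands in for a dimension argument: if \<open>F\<close> has at least two elements,
  its star ideal of height two is of linear type and needs \<open>card F choose 1\<close>
  generators, a number that linear type bounds by \<open>CARD('v)\<close>.\<close>

lemma card_regular_sequence_set_le:
  fixes F :: "('v::finite, 'k::field) mvpoly set"
  assumes "finite F" "\<forall>f\<in>F. homogeneous f" "regular_sequence_set F"
  shows "card F \<le> CARD('v)"
proof (cases "2 \<le> card F")
  case True
  have pos: "pos_homogeneous f" if "f \<in> F" for f
    using regular_sequence_set_pos_homogeneous assms that by blast
  have nzd: "nonzerodivisor_mod f T" if "T \<subseteq> F" "f \<in> F - T" for f T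
    using regular_sequence_set_nonzerodivisor assms that by blast
  have "card F choose (2 - 1) \<le> CARD('v)"
    using star_like_2[OF assms(1) True pos nzd] linear_type_star_ideal_2[OF assms(1) True pos nzd]
    by (rule linear_type_star_ideal_imp_le)
  then show ?thesis by simp
next
  case False
  moreover have "1 \<le> CARD('v)" by (simp add: Suc_leI)
  ultimately show ?thesis by linarith
qed

section \<open>Binomial inequalities\<close>

lemma binomial_ge: "1 \<le> k \<Longrightarrow> k < t \<Longrightarrow> t \<le> t choose k"
proof (induction t arbitrary: k)
  case (Suc t)
  then obtain j where k: "k = Suc j" by (cases k) auto
  show ?case
  proof (cases "k = t")
    case True
    then show ?thesis by simp
  next
    case False
    then have "t \<le> t choose k" "0 < t choose j" using Suc k by auto
    then show ?thesis unfolding k binomial_Suc_Suc by linarith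
  qed
qed simp

text \<open>Both summands of Pascal's rule are at least \<open>t - 1\<close>, and
  \<open>2 * (t - 1) > t\<close> since \<open>t \<ge> 4\<close>.\<close>

lemma binomial_gt:
  assumes "2 \<le> k" "k + 2 \<le> t"
  shows "t < t choose k"
proof -
  obtain s where s: "t = Suc s" using assms by (cases t) auto
  obtain j where j: "k = Suc j" using assms by (cases k) auto
  have "s \<le> s choose k" "s \<le> s choose j" using assms s j by (auto intro!: binomial_ge)
  then show ?thesis using assms s j by simp
qed

section \<open>The equivalence\<close>

text \<open>As \<open>c < card F\<close>, an element \<open>f\<close> and a set \<open>T\<close> of
  at most \<open>c\<close> elements fit into a subset of size \<open>c + 1\<close>. That subset is a
  regular sequence in some order, and permutability does the rest.\<close>

lemma star_configuration_star_like:
  fixes F :: "('v::finite, 'k::field) mvpoly set"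
  assumes star: "star_configuration c F" and "c < card F"
  shows "star_like c F"
proof -
  have fin: "finite F" and hom: "\<forall>f\<in>F. homogeneous f" and c: "1 \<le> c"
    and reg: "\<And>S. S \<subseteq> F \<Longrightarrow> card S = c + 1 \<Longrightarrow> regular_sequence_set S"
    using star by (auto simp: star_configuration_def)
  have ext: "\<exists>G. insert f T \<subseteq> G \<and> G \<subseteq> F \<and> card G = c + 1" if "f \<in> F" "T \<subseteq> F" "card T \<le> c" for f T
    using that assms(2) fin finite_subset[OF that(2) fin]
    by (intro exists_subset_between) (auto simp: card_insert_if)
  have "pos_homogeneous f" if "f \<in> F" for f
  proof -
    obtain G where "f \<in> G" "G \<subseteq> F" "card G = c + 1" using ext[of f "{}"] \<open>f \<in> F\<close> by auto
    then show ?thesis using regular_sequence_set_pos_homogeneous[of G f] reg hom by blast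
  qed
  moreover have "nonzerodivisor_mod f T" if "T \<subseteq> F" "card T \<le> c" "f \<in> F - T" for f T
  proof -
    from ext[of f T] that obtain G where "insert f T \<subseteq> G" "G \<subseteq> F" "card G = c + 1" by auto
    then show ?thesis using regular_sequence_set_nonzerodivisor[of G T f] reg hom that(3) by blast
  qed
  ultimately show ?thesis using fin c assms(2) by (auto simp: star_like_def)
qed

text \<open>The two assumptions on \<open>c\<close> exclude cases with few generators but
  \<open>c \<noteq> 2\<close>. For \<open>c = 1\<close> the star ideal is principal. For
  \<open>c = card F\<close> the sets of size \<open>c + 1\<close> impose no condition,
  \<open>reg\<close> forces \<open>card F = CARD('v)\<close>, and the star ideal is generated by the
  elements of \<open>F\<close>.\<close>

theorem theorem4p1:
  fixes F :: "('v::finite, 'k::field) mvpoly set" and c :: nat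
  assumes star: "star_configuration c F"
    and reg: "\<exists>S\<subseteq>F. card S = CARD('v) \<and> regular_sequence_set S"
    and height_ne_1: "c \<noteq> 1"
    and height_eq_card: "c = card F \<longrightarrow> c = 2"
  shows "(linear_type (star_ideal c F) \<longleftrightarrow> min_gens (star_ideal c F) \<le> CARD('v))
       \<and> (min_gens (star_ideal c F) \<le> CARD('v) \<longleftrightarrow> c = 2 \<and> CARD('v) = card F)
       \<and> (CARD('v) = card F \<longleftrightarrow> regular_sequence_set F)"
proof -
  have fin: "finite F" and hom: "\<forall>f\<in>F. homogeneous f" and c: "2 \<le> c" "c \<le> CARD('v)" "c \<le> card F"
    using star height_ne_1 by (auto simp: star_configuration_def)
  obtain S where S: "S \<subseteq> F" "card S = CARD('v)" "regular_sequence_set S" using reg by blast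
  have n_le: "CARD('v) \<le> card F" using S card_mono[OF fin] by metis
  have F_reg: "regular_sequence_set F" if "CARD('v) = card F"
    using card_subset_eq[OF fin S(1)] S that by simp
  have pos: "pos_homogeneous f" if "regular_sequence_set F" "f \<in> F" for f
    using regular_sequence_set_pos_homogeneous hom that by blast
  have nzd: "nonzerodivisor_mod f T" if "regular_sequence_set F" "T \<subseteq> F" "f \<in> F - T" for f T
    using regular_sequence_set_nonzerodivisor hom that by blast
  have two: "2 \<le> card F" using c by simp
  have like: "star_like c F"
  proof (cases "c = card F")
    case True
    \<comment> \<open>Here \<open>CARD('v) \<le> card F = c \<le> CARD('v)\<close>, so
      \<open>F\<close> itself is the given regular sequence.\<close>
    then have "c = 2" "CARD('v) = card F" using height_eq_card c n_le by auto
    then show ?thesis using star_like_2[OF fin two pos nzd] F_reg by blast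
  next
    case False
    then show ?thesis using star_configuration_star_like[OF star] c by simp
  qed
  have gens: "min_gens (star_ideal c F) = card F choose (c - 1)" by (rule min_gens_star_ideal[OF like])
  have 12: "min_gens (star_ideal c F) \<le> CARD('v)" if "linear_type (star_ideal c F)"
    using linear_type_star_ideal_imp_le[OF like that] gens by simp
  have 23: "c = 2 \<and> CARD('v) = card F" if le: "min_gens (star_ideal c F) \<le> CARD('v)"
  proof (cases "c = 2")
    case False
    \<comment> \<open>Now \<open>c\<close> lies strictly between 2 and \<open>card F\<close>, so the
      number of generators exceeds \<open>card F\<close>, which is at least
      \<open>CARD('v)\<close>.\<close>
    then have "2 \<le> c - 1" "c - 1 + 2 \<le> card F" using c height_eq_card by auto
    then show ?thesis using binomial_gt[of "c - 1" "card F"] le gens n_le by simp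
  next
    case True
    then show ?thesis using le gens n_le by simp
  qed
  have 31: "linear_type (star_ideal c F)" if "c = 2 \<and> CARD('v) = card F"
    using linear_type_star_ideal_2[OF fin two pos nzd] F_reg that by blast
  have "CARD('v) = card F" if "regular_sequence_set F"
    using card_regular_sequence_set_le[OF fin hom that] n_le by simp
  with 12 23 31 F_reg show ?thesis by blast
qed

end
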